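(* Let $k$ be a field. For $1\le i\le t$ let $M_i=U(n_i-1,n_i)$ with $n_i\ge 2$. Assume $E(M_i)\cap E(M_{i+1})=\{p_{i+1}\}$ for $1\le i\le t-1$, $E(M_i)\cap E(M_j)=\emptyset$ for $|i-j|\ge2$, and $p_i\neq p_j$ for $i\neq j$. Then the parallel connection $M=P(M_1,\ldots,M_t;p_2,\ldots,p_t)$ has an NBC basis.
   Context: $U(r,n)$ is the uniform matroid on an $n$-element set whose bases are all $r$-element subsets. For matroids $M,N$ with $p\in E(M)\cap E(N)$, $P(M,N;p)$ is the matroid on $E(M)\cup E(N)$ with circuits $\mathcal{C}(M)\cup\mathcal{C}(N)\cup\{(C_1\cup C_2)\setminus\{p\}: C_1\in\mathcal{C}(M), C_2\in\mathcal{C}(N), p\in C_1\cap C_2\}$. $P(M_1,\ldots,M_t;p_2,\ldots,p_t)=P_t$ where $P_1=M_1$ and $P_i=P(P_{i-1},M_i;p_i)$ for $2\le i\le t$. NBC basis: for a regular matroid $N$ of rank $s$ with ground set ordered $e_1<\cdots<e_m$ such that $B=\{e_{m-s+1},\ldots,e_m\}$ is a basis, let $\mathrm{ci}(B,e)$ ($e\notin B$) be the unique circuit in $B\cup\{e\}$ and $\mathrm{coc}(B,b)$ ($b\in B$) the unique cocircuit in $(E\setminus B)\cup\{b\}$ containing $b$. With an admissible signed fundamental cocircuit incidence matrix $(a^*_{ji})$ (a $\pm1$-signing of the $0/1$ incidence matrix of the cocircuits $\mathrm{coc}(B,e_j)$, restricted from a signing of the full cocircuit incidence matrix that is orthogonal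 over $k$ to some signing of the full circuit incidence matrix), put $\Theta^B=\{\sum_{e_i\in\mathrm{coc}(B,e_j)}a^*_{ji}x_i: e_j\in B\}$ and $k(\Delta_{\mathrm{BC}}(N))=k[x_1,\ldots,x_m]/(\langle\prod_{e_i\in\overline{C}}x_i : C\text{ circuit}\rangle+(\Theta^B))$, where $\overline{C}=C\setminus\{\min C\}$. Label circuits with $C_i=\mathrm{ci}(B,e_i)$ for $i\le m-s$; let $d_j=j$ for $j\le m-s$, $d_j=\min\{i: e_i\in\mathrm{coc}(B,e_j)\}$ for $j>m-s$; $m_{C_i}=x_i^{|\overline{C}_i|}$ for $i\le m-s$ and $m_{C_i}=\prod_{e_j\in\overline{C}_i}x_{d_j}$ otherwise; $L(N)$ = monomials in $x_1,\ldots,x_{m-s}$ divisible by no $m_C$. $N$ has an NBC basis if for some such ordering the images of $L(N)$ form a $k$-basis of $k(\Delta_{\mathrm{BC}}(N))$. *)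

theory Defs
  imports Main "HOL-Library.Poly_Mapping"
begin

type_synonym 'a matroid = "'a set \<times> 'a set set"

definition gnd :: "'a matroid \<Rightarrow> 'a set" where "gnd M = fst M"
definition circuits :: "'a matroid \<Rightarrow> 'a set set" where "circuits M = snd M"

definition indep :: "'a matroid \<Rightarrow> 'a set \<Rightarrow> bool" where
  "indep M I \<longleftrightarrow> I \<subseteq> gnd M \<and> \<not> (\<exists>C\<in>circuits M. C \<subseteq> I)"

definition is_basis :: "'a matroid \<Rightarrow> 'a set \<Rightarrow> bool" where
  "is_basis M B \<longleftrightarrow> indep M B \<and> (\<forall>I. indep M I \<longrightarrow> B \<subseteq> I \<longrightarrow> I = B)"

definition mrank :: "'a matroid \<Rightarrow> nat" where
  "mrank M = Max {card I | I. indep M I}"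

definition is_cocircuit :: "'a matroid \<Rightarrow> 'a set \<Rightarrow> bool" where
  "is_cocircuit M D \<longleftrightarrow> D \<subseteq> gnd M \<and> D \<noteq> {} \<and> (\<forall>B. is_basis M B \<longrightarrow> D \<inter> B \<noteq> {}) \<and>
     (\<forall>D'. D' \<subset> D \<longrightarrow> D' = {} \<or> (\<exists>B. is_basis M B \<and> D' \<inter> B = {}))"

definition cocircuits :: "'a matroid \<Rightarrow> 'a set set" where
  "cocircuits M = {D. is_cocircuit M D}"

definition fund_ci :: "'a matroid \<Rightarrow> 'a set \<Rightarrow> 'a \<Rightarrow> 'a set" where
  "fund_ci M B e = (THE C. C \<in> circuits M \<and> C \<subseteq> insert e B)"

definition fund_coc :: "'a matroid \<Rightarrow> 'a set \<Rightarrow> 'a \<Rightarrow> 'a set" where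
  "fund_coc M B b = (THE D. is_cocircuit M D \<and> D \<subseteq> insert b (gnd M - B) \<and> b \<in> D)"

text \<open>\<open>U(r,n)\<close> on an \<open>n\<close>-element ground set \<open>E\<close>: bases are the \<open>r\<close>-subsets,
  so circuits are the \<open>(r+1)\<close>-subsets.\<close>
definition uniform_matroid :: "nat \<Rightarrow> 'a set \<Rightarrow> 'a matroid" where
  "uniform_matroid r E = (E, {C. C \<subseteq> E \<and> card C = r + 1})"

definition par_conn :: "'a matroid \<Rightarrow> 'a matroid \<Rightarrow> 'a \<Rightarrow> 'a matroid" where
  "par_conn M N p = (gnd M \<union> gnd N,
     circuits M \<union> circuits N \<union>
     {(C1 \<union> C2) - {p} | C1 C2. C1 \<in> circuits M \<and> C2 \<in> circuits N \<and> p \<in> C1 \<and> p \<in> C2})"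

text \<open>\<open>par_iter M p i\<close> is \<open>P_{i+1}\<close>; so \<open>P(M_1,\<dots>,M_t;p_2,\<dots>,p_t) = par_iter M p (t-1)\<close>.\<close>
primrec par_iter :: "(nat \<Rightarrow> 'a matroid) \<Rightarrow> (nat \<Rightarrow> 'a) \<Rightarrow> nat \<Rightarrow> 'a matroid" where
  "par_iter M p 0 = M 1"
| "par_iter M p (Suc i) = par_conn (par_iter M p i) (M (i + 2)) (p (i + 2))"

type_synonym 'k mpoly = "(nat \<Rightarrow>\<^sub>0 nat) \<Rightarrow>\<^sub>0 'k"

definition var_poly :: "nat \<Rightarrow> ('k::comm_ring_1) mpoly" where
  "var_poly i = Poly_Mapping.single (Poly_Mapping.single i 1) 1"

definition poly_in_vars :: "nat set \<Rightarrow> ('k::comm_ring_1) mpoly \<Rightarrow> bool" where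
  "poly_in_vars V f \<longleftrightarrow> (\<forall>a\<in>Poly_Mapping.keys f. Poly_Mapping.keys a \<subseteq> V)"

definition ideal_gen :: "nat set \<Rightarrow> ('k::comm_ring_1) mpoly set \<Rightarrow> 'k mpoly set" where
  "ideal_gen V G = {f. \<exists>F c. finite F \<and> F \<subseteq> G \<and> (\<forall>g\<in>F. poly_in_vars V (c g)) \<and>
                           f = (\<Sum>g\<in>F. c g * g)}"

text \<open>\<open>e\<close> enumerates the ground set as \<open>e_1 < \<dots> < e_m\<close>; \<open>idx\<close> is its inverse.\<close>

definition elt_idx :: "(nat \<Rightarrow> 'a) \<Rightarrow> nat \<Rightarrow> 'a \<Rightarrow> nat" where
  "elt_idx e m x = (THE i. i \<in> {1..m} \<and> e i = x)"

definition cmin :: "(nat \<Rightarrow> 'a) \<Rightarrow> nat \<Rightarrow> 'a set \<Rightarrow> 'a set" where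
  "cmin e m C = C - {e (Min (elt_idx e m ` C))}"

definition admissible_signing :: "'k::field itself \<Rightarrow> 'a matroid \<Rightarrow> ('a set \<Rightarrow> 'a \<Rightarrow> int) \<Rightarrow>
    ('a set \<Rightarrow> 'a \<Rightarrow> int) \<Rightarrow> bool" where
  "admissible_signing _ N \<sigma> \<tau> \<longleftrightarrow>
     (\<forall>C\<in>circuits N. \<forall>x. (x \<in> C \<longrightarrow> \<sigma> C x \<in> {1, -1}) \<and> (x \<notin> C \<longrightarrow> \<sigma> C x = 0)) \<and>
     (\<forall>D\<in>cocircuits N. \<forall>x. (x \<in> D \<longrightarrow> \<tau> D x \<in> {1, -1}) \<and> (x \<notin> D \<longrightarrow> \<tau> D x = 0)) \<and>
     (\<forall>C\<in>circuits N. \<forall>D\<in>cocircuits N. (\<Sum>x\<in>gnd N. (of_int (\<sigma> C x * \<tau> D x) :: 'k)) = 0)"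

definition Theta :: "'k::field itself \<Rightarrow> 'a matroid \<Rightarrow> (nat \<Rightarrow> 'a) \<Rightarrow> ('a set \<Rightarrow> 'a \<Rightarrow> int)
    \<Rightarrow> 'k mpoly set" where
  "Theta _ N e \<tau> = (let m = card (gnd N); s = mrank N; B = e ` {m - s + 1..m} in
     {(\<Sum>i\<in>{1..m}. if e i \<in> fund_coc N B (e j)
          then of_int (\<tau> (fund_coc N B (e j)) (e i)) * var_poly i else 0) | j. j \<in> {m - s + 1..m}})"

definition circuit_gens :: "'k::field itself \<Rightarrow> 'a matroid \<Rightarrow> (nat \<Rightarrow> 'a) \<Rightarrow> 'k mpoly set" where
  "circuit_gens _ N e = (let m = card (gnd N) in
     {(\<Prod>x\<in>cmin e m C. var_poly (elt_idx e m x)) | C. C \<in> circuits N})"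

definition BC_ideal :: "'k::field itself \<Rightarrow> 'a matroid \<Rightarrow> (nat \<Rightarrow> 'a) \<Rightarrow> ('a set \<Rightarrow> 'a \<Rightarrow> int)
    \<Rightarrow> 'k mpoly set" where
  "BC_ideal K N e \<tau> = ideal_gen {1..card (gnd N)} (circuit_gens K N e \<union> Theta K N e \<tau>)"

definition dval :: "'a matroid \<Rightarrow> (nat \<Rightarrow> 'a) \<Rightarrow> nat \<Rightarrow> nat" where
  "dval N e j = (let m = card (gnd N); s = mrank N; B = e ` {m - s + 1..m} in
     if j \<le> m - s then j else Min {i \<in> {1..m}. e i \<in> fund_coc N B (e j)})"

definition mC_exp :: "'a matroid \<Rightarrow> (nat \<Rightarrow> 'a) \<Rightarrow> 'a set \<Rightarrow> nat \<Rightarrow>\<^sub>0 nat" where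
  "mC_exp N e C = (let m = card (gnd N); s = mrank N; B = e ` {m - s + 1..m} in
     if \<exists>i\<in>{1..m - s}. C = fund_ci N B (e i)
     then Poly_Mapping.single (THE i. i \<in> {1..m - s} \<and> C = fund_ci N B (e i)) (card (cmin e m C))
     else (\<Sum>x\<in>cmin e m C. Poly_Mapping.single (dval N e (elt_idx e m x)) 1))"

definition divides_exp :: "(nat \<Rightarrow>\<^sub>0 nat) \<Rightarrow> (nat \<Rightarrow>\<^sub>0 nat) \<Rightarrow> bool" where
  "divides_exp a b \<longleftrightarrow> (\<forall>i. Poly_Mapping.lookup a i \<le> Poly_Mapping.lookup b i)"

definition L_set :: "'a matroid \<Rightarrow> (nat \<Rightarrow> 'a) \<Rightarrow> (nat \<Rightarrow>\<^sub>0 nat) set" where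
  "L_set N e = {a. Poly_Mapping.keys a \<subseteq> {1..card (gnd N) - mrank N} \<and>
                   (\<forall>C\<in>circuits N. \<not> divides_exp (mC_exp N e C) a)}"

definition monomials_basis_mod :: "nat set \<Rightarrow> ('k::field) mpoly set \<Rightarrow> (nat \<Rightarrow>\<^sub>0 nat) set \<Rightarrow> bool" where
  "monomials_basis_mod V I L \<longleftrightarrow>
     (\<forall>F c. finite F \<and> F \<subseteq> L \<and> (\<Sum>a\<in>F. Poly_Mapping.single a (c a)) \<in> I \<longrightarrow> (\<forall>a\<in>F. c a = 0)) \<and>
     (\<forall>f. poly_in_vars V f \<longrightarrow>
        (\<exists>F c. finite F \<and> F \<subseteq> L \<and> f - (\<Sum>a\<in>F. Poly_Mapping.single a (c a)) \<in> I))"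

definition has_NBC_basis :: "'k::field itself \<Rightarrow> 'a matroid \<Rightarrow> bool" where
  "has_NBC_basis K N \<longleftrightarrow>
    (\<exists>e \<sigma> \<tau>. let m = card (gnd N); s = mrank N in
       bij_betw e {1..m} (gnd N) \<and>
       is_basis N (e ` {m - s + 1..m}) \<and>
       admissible_signing K N \<sigma> \<tau> \<and>
       monomials_basis_mod {1..m} (BC_ideal K N e \<tau>) (L_set N e))"

end

theory Submission
  imports Defs
begin

text \<open>
  The coordinates of the signed cycle \<open>\<Sum>\<^sub>i y\<^sub>i E\<^sub>i\<close> are \<open>y\<^sub>i\<close> on the private elements of \<open>E\<^sub>i\<close> and
  \<open>y\<^sub>k - y\<^sub>k\<^sub>-\<^sub>1\<close> on the shared element \<open>p\<^sub>k\<close>, so killing \<open>\<Theta>\<^sup>B\<close> identifies the ring with a quotient of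
  \<open>k[y\<^sub>1,\<dots>,y\<^sub>t]\<close> by products of these linear forms, one for each interval of consecutive cycles.
  Let \<open>e\<^sub>i\<close> be a private element of \<open>E\<^sub>i\<close>, or \<open>p\<^sub>i\<close> if there is none, and let \<open>e\<^sub>1,\<dots>,e\<^sub>t\<close> come first.
  Then every \<open>m\<^sub>C\<close> is a multiple of some \<open>x\<^sub>i\<close> to the power \<open>n\<^sub>i - 1\<close>, so \<open>L\<close> is the box of all
  monomials with exponents below \<open>n\<^sub>i - 1\<close>. The box is a basis by induction on the number of cycles,
  for the more general family of quotients in which the factor contributed by the first cycle is an
  arbitrary monic polynomial in its variable.
\<close>

text \<open>Two obstacles shape the argument. First, removing a cycle does not leave a chain of the
  same kind: once q is factored out and y_i = y_{i+1} is imposed, an interval starting at i becomes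
  one starting at i + 1 whose head is a pure power of y_{i+1}. An arbitrary monic head covers this
  shape and the unaltered head (y_{i+1} - y_i) y_{i+1}^{s-1}. The latter is monic only over
  polynomials in y_i, so a set \<open>U\<close> of unrestricted variables serves as coefficient ring
  in the induction. Second, a cycle without private elements is {p_i, p_{i+1}}. Its representative
  is then shared, so x_i corresponds to y_i - y_{i-1} and not to y_i, and fundamental circuits may
  run through several cycles. But here n_i - 1 = 1, so x_i does not occur in the box; both changes
  of variables fix the box pointwise, which transfers the basis. The bound n_i - 1 is the degree of
  the head of cycle i, plus one if i < t. The head has degree s_i, the number of private elements,
  except that it is s_1 - 1 for i = 1.\<close>

abbreviation (input) "lookup \<equiv> Poly_Mapping.lookup"
abbreviation (input) "keys \<equiv> Poly_Mapping.keys"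
abbreviation (input) "single \<equiv> Poly_Mapping.single"

subsection \<open>Polynomials with restricted exponents\<close>

text \<open>One exponent set per variable expresses variable sets, degree bounds and boxes alike:
  \<open>S(i := {0})\<close> means free of variable i, \<open>S(i := {..<n})\<close> means degree
  below n in it, and the conditions on all other variables stay as they were.\<close>

definition bpolys :: "(nat \<Rightarrow> nat set) \<Rightarrow> ('k::comm_ring_1) mpoly set" where
  "bpolys S = {f. \<forall>m\<in>keys f. \<forall>l. lookup m l \<in> S l}"

definition vars_bound :: "nat set \<Rightarrow> nat \<Rightarrow> nat set" where
  "vars_bound V l = (if l \<in> V then UNIV else {0})"

lemma poly_in_vars_iff: "poly_in_vars V f \<longleftrightarrow> f \<in> bpolys (vars_bound V)"
  unfolding poly_in_vars_def bpolys_def vars_bound_def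
  by (simp add: in_keys_iff subset_iff) (metis neq0_conv)

lemma bpolys_zero [simp]: "0 \<in> bpolys S"
  by (simp add: bpolys_def)

lemma bpolys_one: "\<forall>l. 0 \<in> S l \<Longrightarrow> 1 \<in> bpolys S"
  by (simp add: bpolys_def)

lemma bpolys_mono: "f \<in> bpolys S \<Longrightarrow> \<forall>l. S l \<subseteq> T l \<Longrightarrow> f \<in> bpolys T"
  unfolding bpolys_def by blast

lemma bpolys_add: "f \<in> bpolys S \<Longrightarrow> g \<in> bpolys S \<Longrightarrow> f + g \<in> bpolys S"
  using keys_add[of f g] unfolding bpolys_def by (auto dest!: subsetD)

lemma bpolys_uminus: "f \<in> bpolys S \<Longrightarrow> - f \<in> bpolys S"
  by (simp add: bpolys_def in_keys_iff)

lemma bpolys_diff: "f \<in> bpolys S \<Longrightarrow> g \<in> bpolys S \<Longrightarrow> f - g \<in> bpolys S"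
  using bpolys_add[of f S "- g"] bpolys_uminus[of g S] by simp

lemma bpolys_sum: "(\<And>a. a \<in> F \<Longrightarrow> f a \<in> bpolys S) \<Longrightarrow> sum f F \<in> bpolys S"
  by (induction F rule: infinite_finite_induct) (auto intro: bpolys_add)

lemma bpolys_mult:
  assumes "f \<in> bpolys S" "g \<in> bpolys T" "\<And>l a b. a \<in> S l \<Longrightarrow> b \<in> T l \<Longrightarrow> a + b \<in> W l"
  shows "f * g \<in> bpolys W"
  unfolding bpolys_def
proof (intro CollectI ballI allI)
  fix m l assume "m \<in> keys (f * g)"
  then obtain a b where "m = a + b" "a \<in> keys f" "b \<in> keys g" using keys_mult[of f g] by blast
  with assms show "lookup m l \<in> W l" by (simp add: bpolys_def lookup_add)
qed

lemma bpolys_single: "\<forall>l. lookup m l \<in> S l \<Longrightarrow> single m c \<in> bpolys S"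
  by (simp add: bpolys_def)

lemma poly_sum_singles: "f = (\<Sum>m\<in>keys f. single m (lookup f m))"
proof (rule poly_mapping_eqI)
  fix k
  have "(\<Sum>m\<in>keys f. lookup (single m (lookup f m)) k) = (\<Sum>m\<in>keys f. if m = k then lookup f k else 0)"
    by (intro sum.cong) (auto simp: lookup_single when_def)
  also have "\<dots> = lookup f k"
    by (simp add: in_keys_iff)
  finally show "lookup f k = lookup (\<Sum>m\<in>keys f. single m (lookup f m)) k"
    by (simp add: lookup_sum)
qed

lemma lookup_sum_single: "finite X \<Longrightarrow> lookup (\<Sum>x\<in>X. single (d x) (1::nat)) l = card {x \<in> X. d x = l}"
  by (simp add: lookup_sum lookup_single when_def sum.If_cases Int_def)

lemma bpolys_induct [consumes 1, case_names single zero add]: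
  assumes "f \<in> bpolys S"
    and "\<And>m c. \<forall>l. lookup m l \<in> S l \<Longrightarrow> P (single m c)"
    and "P 0" and "\<And>f g. P f \<Longrightarrow> P g \<Longrightarrow> P (f + g)"
  shows "P f"
proof -
  have "P (\<Sum>m\<in>A. single m (lookup f m))" if "A \<subseteq> keys f" for A
    using finite_subset[OF that finite_keys] that
  proof (induction A rule: finite_induct)
    case (insert m A)
    then have "\<forall>l. lookup m l \<in> S l" using assms(1) by (auto simp: bpolys_def)
    with insert show ?case by (simp add: assms)
  qed (simp add: assms)
  then show ?thesis using poly_sum_singles[of f] by (metis order_refl)
qed

lemma var_power: "var_poly i ^ d = (single (single i d) 1 :: ('k::comm_ring_1) mpoly)"
proof (induction d)
  case (Suc d)
  have "single i d + single i (Suc 0) = single i (Suc d)"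
    by (simp flip: single_add)
  with Suc show ?case by (simp add: var_poly_def mult_single add.commute)
qed simp

lemma bpolys_var_power: "d \<in> S i \<Longrightarrow> \<forall>l. l \<noteq> i \<longrightarrow> 0 \<in> S l \<Longrightarrow> var_poly i ^ d \<in> bpolys S"
  unfolding var_power by (rule bpolys_single) (auto simp: lookup_single when_def)

lemma bpolys_var: "1 \<in> S i \<Longrightarrow> \<forall>l. l \<noteq> i \<longrightarrow> 0 \<in> S l \<Longrightarrow> var_poly i \<in> bpolys S"
  using bpolys_var_power[of 1] by simp

lemma vars_zero [simp]: "poly_in_vars V 0"
  by (simp add: poly_in_vars_iff)

lemma vars_one [simp]: "poly_in_vars V 1"
  by (simp add: poly_in_vars_iff vars_bound_def bpolys_one)

lemma vars_add [intro]: "poly_in_vars V f \<Longrightarrow> poly_in_vars V g \<Longrightarrow> poly_in_vars V (f + g)"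
  by (simp add: poly_in_vars_iff bpolys_add)

lemma vars_diff [intro]: "poly_in_vars V f \<Longrightarrow> poly_in_vars V g \<Longrightarrow> poly_in_vars V (f - g)"
  by (simp add: poly_in_vars_iff bpolys_diff)

lemma vars_uminus [intro]: "poly_in_vars V f \<Longrightarrow> poly_in_vars V (- f)"
  by (simp add: poly_in_vars_iff bpolys_uminus)

lemma vars_mult [intro]: "poly_in_vars V f \<Longrightarrow> poly_in_vars V g \<Longrightarrow> poly_in_vars V (f * g)"
  unfolding poly_in_vars_iff by (erule bpolys_mult) (auto simp: vars_bound_def split: if_splits)

lemma vars_sum [intro]: "(\<And>a. a \<in> F \<Longrightarrow> poly_in_vars V (f a)) \<Longrightarrow> poly_in_vars V (sum f F)"
  by (simp add: poly_in_vars_iff bpolys_sum)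

lemma vars_prod [intro]: "(\<And>a. a \<in> F \<Longrightarrow> poly_in_vars V (f a)) \<Longrightarrow> poly_in_vars V (prod f F)"
  by (induction F rule: infinite_finite_induct) auto

lemma vars_power [intro]: "poly_in_vars V f \<Longrightarrow> poly_in_vars V (f ^ d)"
  by (induction d) auto

lemma vars_var [simp]: "poly_in_vars V (var_poly i) \<longleftrightarrow> i \<in> V"
  by (auto simp: poly_in_vars_def var_poly_def)

lemma vars_const [simp]: "poly_in_vars V (single 0 c)"
  by (auto simp: poly_in_vars_def)

lemma vars_of_int [simp]: "poly_in_vars V (of_int c)"
  by (metis single_of_int vars_const)

lemma vars_mono: "poly_in_vars V f \<Longrightarrow> V \<subseteq> V' \<Longrightarrow> poly_in_vars V' f"
  by (auto simp: poly_in_vars_def)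

subsection \<open>Ideals\<close>

lemma ideal_gen_zero [simp]: "0 \<in> ideal_gen V G"
  unfolding ideal_gen_def by (auto intro!: exI[of _ "{}"])

lemma ideal_gen_add:
  assumes "f \<in> ideal_gen V G" "g \<in> ideal_gen V G"
  shows "f + g \<in> ideal_gen V G"
proof -
  obtain F c where f: "finite F" "F \<subseteq> G" "\<forall>h\<in>F. poly_in_vars V (c h)" "f = (\<Sum>h\<in>F. c h * h)"
    using assms(1) unfolding ideal_gen_def by auto
  obtain F' c' where g: "finite F'" "F' \<subseteq> G" "\<forall>h\<in>F'. poly_in_vars V (c' h)" "g = (\<Sum>h\<in>F'. c' h * h)"
    using assms(2) unfolding ideal_gen_def by auto
  let ?d = "\<lambda>h. (if h \<in> F then c h else 0) + (if h \<in> F' then c' h else 0)"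
  have "f = (\<Sum>h\<in>F \<union> F'. (if h \<in> F then c h else 0) * h)"
    unfolding f(4) using f(1) g(1) by (intro sum.mono_neutral_cong_left) auto
  moreover have "g = (\<Sum>h\<in>F \<union> F'. (if h \<in> F' then c' h else 0) * h)"
    unfolding g(4) using f(1) g(1) by (intro sum.mono_neutral_cong_left) auto
  ultimately have "f + g = (\<Sum>h\<in>F \<union> F'. ?d h * h)"
    by (simp add: sum.distrib algebra_simps)
  moreover have "\<forall>h\<in>F \<union> F'. poly_in_vars V (?d h)"
    using f(3) g(3) by auto
  moreover have "finite (F \<union> F')" "F \<union> F' \<subseteq> G" using f g by auto
  ultimately show ?thesis unfolding ideal_gen_def by (auto intro!: exI[of _ "F \<union> F'"] exI[of _ ?d])
qed

lemma ideal_gen_mult: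
  assumes "f \<in> ideal_gen V G" "poly_in_vars V h"
  shows "h * f \<in> ideal_gen V G"
proof -
  obtain F c where f: "finite F" "F \<subseteq> G" "\<forall>g\<in>F. poly_in_vars V (c g)" "f = (\<Sum>g\<in>F. c g * g)"
    using assms(1) unfolding ideal_gen_def by auto
  have "h * f = (\<Sum>g\<in>F. (h * c g) * g)" unfolding f(4) by (simp add: sum_distrib_left mult.assoc)
  moreover have "\<forall>g\<in>F. poly_in_vars V (h * c g)" using f(3) assms(2) by auto
  ultimately show ?thesis using f(1,2) unfolding ideal_gen_def
    by (auto intro!: exI[of _ F] exI[of _ "\<lambda>g. h * c g"])
qed

lemma ideal_gen_gen: "g \<in> G \<Longrightarrow> g \<in> ideal_gen V G"
  unfolding ideal_gen_def by (auto intro!: exI[of _ "{g}"] exI[of _ "\<lambda>_. 1"])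

lemma ideal_gen_uminus: "f \<in> ideal_gen V G \<Longrightarrow> - f \<in> ideal_gen V G"
  using ideal_gen_mult[of f V G "- 1"] vars_uminus[OF vars_one, of V] by simp

lemma ideal_gen_diff: "f \<in> ideal_gen V G \<Longrightarrow> g \<in> ideal_gen V G \<Longrightarrow> f - g \<in> ideal_gen V G"
  using ideal_gen_add[of f V G "- g"] ideal_gen_uminus[of g V G] by simp

lemma ideal_gen_induct [consumes 1, case_names gen zero add]:
  assumes "f \<in> ideal_gen V G"
    and "\<And>c g. g \<in> G \<Longrightarrow> poly_in_vars V c \<Longrightarrow> P (c * g)"
    and "P 0" and "\<And>f g. P f \<Longrightarrow> P g \<Longrightarrow> P (f + g)"
  shows "P f"
proof -
  obtain F c where f: "finite F" "F \<subseteq> G" "\<forall>g\<in>F. poly_in_vars V (c g)" "f = (\<Sum>g\<in>F. c g * g)"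
    using assms(1) unfolding ideal_gen_def by auto
  from f(1-3) have "P (\<Sum>g\<in>F. c g * g)"
    by (induction F rule: finite_induct) (auto intro: assms)
  with f(4) show ?thesis by simp
qed

subsection \<open>Substitution homomorphisms\<close>

definition msubst :: "(nat \<Rightarrow> ('k::comm_ring_1) mpoly) \<Rightarrow> (nat \<Rightarrow>\<^sub>0 nat) \<Rightarrow> 'k mpoly" where
  "msubst h m = (\<Prod>l\<in>keys m. h l ^ lookup m l)"

definition psubst :: "(nat \<Rightarrow> ('k::comm_ring_1) mpoly) \<Rightarrow> 'k mpoly \<Rightarrow> 'k mpoly" where
  "psubst h f = (\<Sum>m\<in>keys f. single 0 (lookup f m) * msubst h m)"

lemma msubst_superset:
  "finite A \<Longrightarrow> keys m \<subseteq> A \<Longrightarrow> msubst h m = (\<Prod>l\<in>A. h l ^ lookup m l)"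
  unfolding msubst_def by (rule prod.mono_neutral_left) (auto simp: in_keys_iff)

lemma msubst_add: "msubst h (a + b) = msubst h a * msubst h b"
proof -
  let ?A = "keys a \<union> keys b"
  have "msubst h (a + b) = (\<Prod>l\<in>?A. h l ^ lookup (a + b) l)"
    by (rule msubst_superset) (auto simp: keys_add)
  also have "\<dots> = (\<Prod>l\<in>?A. h l ^ lookup a l) * (\<Prod>l\<in>?A. h l ^ lookup b l)"
    by (simp add: lookup_add power_add prod.distrib)
  finally show ?thesis by (simp flip: msubst_superset)
qed

lemma psubst_superset:
  "finite A \<Longrightarrow> keys f \<subseteq> A \<Longrightarrow> psubst h f = (\<Sum>m\<in>A. single 0 (lookup f m) * msubst h m)"
  unfolding psubst_def by (rule sum.mono_neutral_left) (auto simp: in_keys_iff)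

lemma psubst_add: "psubst h (f + g) = psubst h f + psubst h g"
proof -
  let ?A = "keys f \<union> keys g"
  have "psubst h (f + g) = (\<Sum>m\<in>?A. single 0 (lookup (f + g) m) * msubst h m)"
    by (rule psubst_superset) (auto simp: keys_add)
  also have "\<dots> = (\<Sum>m\<in>?A. single 0 (lookup f m) * msubst h m) + (\<Sum>m\<in>?A. single 0 (lookup g m) * msubst h m)"
    by (simp add: lookup_add single_add distrib_right sum.distrib)
  finally show ?thesis by (simp flip: psubst_superset)
qed

lemma psubst_zero [simp]: "psubst h 0 = 0"
  by (simp add: psubst_def)

lemma psubst_single: "psubst h (single m c) = single 0 c * msubst h m"
  by (simp add: psubst_def)

lemma psubst_mult: "psubst h (f * g) = psubst h f * psubst h g"
proof -
  have f: "f \<in> bpolys (\<lambda>_. UNIV)" and g: "g \<in> bpolys (\<lambda>_. UNIV)" by (auto simp: bpolys_def)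
  have *: "psubst h (single m c * g) = psubst h (single m c) * psubst h g" for m c
    using g
  proof (induction g rule: bpolys_induct)
    case (single m' d)
    have "psubst h (single m c * single m' d) = single 0 (c * d) * (msubst h m * msubst h m')"
      by (simp add: mult_single psubst_single msubst_add)
    also have "single 0 (c * d) = single 0 c * (single 0 d :: 'a mpoly)" by (simp add: mult_single)
    finally show ?case by (simp only: psubst_single mult_ac)
  qed (auto simp: psubst_add distrib_left)
  show ?thesis using f
    by (induction f rule: bpolys_induct) (auto simp: * psubst_add distrib_right)
qed

lemma psubst_const [simp]: "psubst h (single 0 c) = single 0 c"
  by (simp add: psubst_single msubst_def)

lemma psubst_one [simp]: "psubst h 1 = 1"
  using psubst_const[of h 1] by simp

lemma psubst_of_int [simp]: "psubst h (of_int c) = of_int c"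
  using psubst_const[of h "of_int c"] by simp

lemma psubst_uminus: "psubst h (- f) = - psubst h f"
  using psubst_mult[of h "- 1" f] psubst_of_int[of h "- 1"] by simp

lemma psubst_diff: "psubst h (f - g) = psubst h f - psubst h g"
  using psubst_add[of h f "- g"] by (simp add: psubst_uminus)

lemma psubst_sum: "psubst h (sum f A) = (\<Sum>a\<in>A. psubst h (f a))"
  by (induction A rule: infinite_finite_induct) (auto simp: psubst_add)

lemma psubst_prod: "psubst h (prod f A) = (\<Prod>a\<in>A. psubst h (f a))"
  by (induction A rule: infinite_finite_induct) (auto simp: psubst_mult)

lemma psubst_power: "psubst h (f ^ d) = psubst h f ^ d"
  by (induction d) (auto simp: psubst_mult)

lemma psubst_var [simp]: "psubst h (var_poly i) = h i"
  by (simp add: var_poly_def psubst_single msubst_def)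

lemmas psubst_simps = psubst_add psubst_mult psubst_diff psubst_uminus psubst_sum psubst_prod psubst_power

lemma single_eq_prod: "single m c = single 0 c * (\<Prod>l\<in>keys m. var_poly l ^ lookup m l)"
  for c :: "'k::comm_ring_1"
proof -
  have "m = (\<Sum>l\<in>keys m. single l (lookup m l))" by (rule poly_sum_singles)
  moreover have "(\<Prod>l\<in>A. var_poly l ^ lookup m l) = (single (\<Sum>l\<in>A. single l (lookup m l)) 1 :: 'k mpoly)" for A
    by (induction A rule: infinite_finite_induct) (auto simp: var_power mult_single)
  ultimately show ?thesis by (simp add: mult_single)
qed

text \<open>The product case keeps the information that both factors lie in \<open>V\<close>,
  because \<open>ideal_gen V\<close> absorbs only multipliers in these variables.\<close>

lemma vars_induct [consumes 1, case_names const var add mult]: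
  assumes "poly_in_vars V f"
    and const: "\<And>c. P (single 0 c)" and var: "\<And>i. i \<in> V \<Longrightarrow> P (var_poly i)"
    and add: "\<And>f g. P f \<Longrightarrow> P g \<Longrightarrow> P (f + g)" 
    and mult: "\<And>f g. poly_in_vars V f \<Longrightarrow> poly_in_vars V g \<Longrightarrow> P f \<Longrightarrow> P g \<Longrightarrow> P (f * g)"
  shows "P f"
proof -
  have one: "P 1" and zero: "P 0" using const[of 1] const[of 0] by simp_all
  have pow: "P (var_poly i ^ d)" if "i \<in> V" for i d
    by (induction d) (use that in \<open>auto intro!: one mult var\<close>)
  have prod: "P (\<Prod>l\<in>A. var_poly l ^ d l)" if "A \<subseteq> V" for A d
    using that by (induction A rule: infinite_finite_induct) (auto intro!: one mult pow vars_prod vars_power)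
  show ?thesis using assms(1) unfolding poly_in_vars_iff
  proof (induction f rule: bpolys_induct)
    case (single m c)
    then have "keys m \<subseteq> V" by (auto simp: vars_bound_def in_keys_iff split: if_splits)
    then show ?case unfolding single_eq_prod[of m c] by (intro mult const prod vars_prod vars_power) auto
  qed (auto intro: zero add)
qed

lemma psubst_vars:
  assumes "poly_in_vars V f" "\<And>i. i \<in> V \<Longrightarrow> poly_in_vars W (h i)"
  shows "poly_in_vars W (psubst h f)"
  using assms(1) by (induction f rule: vars_induct) (auto simp: psubst_simps assms(2))

lemma psubst_id:
  assumes "poly_in_vars V f" "\<And>i. i \<in> V \<Longrightarrow> h i = var_poly i"
  shows "psubst h f = f"
  using assms(1) by (induction f rule: vars_induct) (auto simp: psubst_simps assms(2))

lemma psubst_comp: "psubst g (psubst h f) = psubst (\<lambda>i. psubst g (h i)) f"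
proof -
  have "poly_in_vars UNIV f" by (simp add: poly_in_vars_def)
  then show ?thesis by (induction f rule: vars_induct) (auto simp: psubst_simps)
qed

text \<open>Congruence between a polynomial and its image is preserved by sums and products, so it
  suffices to check it on the variables.\<close>

lemma psubst_diff_in_ideal:
  assumes "poly_in_vars V f" "\<And>i. i \<in> V \<Longrightarrow> poly_in_vars V (h i)"
    and "\<And>i. i \<in> V \<Longrightarrow> var_poly i - h i \<in> ideal_gen V G"
  shows "f - psubst h f \<in> ideal_gen V G"
  using assms(1)
proof (induction f rule: vars_induct)
  case (add f g)
  then show ?case using ideal_gen_add[of "f - psubst h f" V G "g - psubst h g"]
    by (simp add: psubst_simps algebra_simps)
next
  case (mult f g)
  have "f * g - psubst h (f * g) = g * (f - psubst h f) + psubst h f * (g - psubst h g)"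
    by (simp add: psubst_simps algebra_simps)
  then show ?case using mult assms(2) by (auto intro!: ideal_gen_add ideal_gen_mult psubst_vars)
qed (auto simp: assms)

subsection \<open>Division by a polynomial that is monic in one variable\<close>

lemma lookup_single_mult: "lookup (single a c * h) (a + m) = c * lookup h m"
  for h :: "('k::comm_ring_1) mpoly"
proof -
  have "h \<in> bpolys (\<lambda>_. UNIV)" by (simp add: bpolys_def)
  then show ?thesis
    by (induction h rule: bpolys_induct)
      (auto simp: mult_single lookup_single when_def distrib_left lookup_add)
qed

lemma bpolys_split:
  assumes "f \<in> bpolys (S(i := {..n}))"
  shows "\<exists>h\<in>bpolys (S(i := {0})). \<exists>g\<in>bpolys (S(i := {..<n})). f = var_poly i ^ n * h + g"
  using assms
proof (induction f rule: bpolys_induct)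
  case (single m c)
  show ?case
  proof (cases "lookup m i = n")
    case True
    let ?m = "m - single i n"
    have m: "m = single i n + ?m"
      by (rule poly_mapping_eqI) (use True in \<open>auto simp: lookup_add lookup_minus lookup_single when_def\<close>)
    have "single m c = var_poly i ^ n * single ?m c"
      by (subst m) (simp add: var_power mult_single)
    moreover have "single ?m c \<in> bpolys (S(i := {0}))"
      by (rule bpolys_single) (use single True in \<open>auto simp: lookup_minus lookup_single when_def split: if_splits\<close>)
    ultimately show ?thesis by - (rule bexI[of _ "single ?m c"], rule bexI[of _ 0], auto simp del: fun_upd_apply)
  next
    case False
    have "lookup m l \<in> (S(i := {..<n})) l" for l
      using single[rule_format, of l] False by (auto split: if_splits)
    then have "single m c \<in> bpolys (S(i := {..<n}))" by (intro bpolys_single) simp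
    then show ?thesis by - (rule bexI[of _ 0], rule bexI[of _ "single m c"], auto simp del: fun_upd_apply)
  qed
next
  case zero
  show ?case by (intro bexI[of _ 0]) auto
next
  case (add f f')
  from add obtain h g h' g' where "h\<in>bpolys (S(i := {0}))" "g\<in>bpolys (S(i := {..<n}))" "f = var_poly i ^ n * h + g"
     "h'\<in>bpolys (S(i := {0}))" "g'\<in>bpolys (S(i := {..<n}))" "f' = var_poly i ^ n * h' + g'" by blast
  then show ?case by - (rule bexI[of _ "h + h'"], rule bexI[of _ "g + g'"], auto simp del: fun_upd_apply simp add: bpolys_add algebra_simps)
qed

text \<open>A monomial of \<open>h\<close>, multiplied by the n-th power of variable i, has degree n
  in that variable and cannot cancel against \<open>g\<close>.\<close>

lemma bpolys_split_unique:
  assumes "h \<in> bpolys (S(i := {0}))" "g \<in> bpolys (S'(i := {..<n}))" "var_poly i ^ n * h + g = 0"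
  shows "h = 0"
proof (rule ccontr)
  assume "h \<noteq> 0"
  then obtain m where m: "m \<in> keys h" by fastforce
  have i: "lookup m i = 0" using assms(1) m unfolding bpolys_def by (metis (mono_tags, lifting) CollectD fun_upd_same singletonD)
  let ?m = "single i n + m"
  have "lookup (var_poly i ^ n * h) ?m = lookup h m"
    unfolding var_power by (simp add: lookup_single_mult)
  moreover have "?m \<notin> keys g"
    using assms(2) i unfolding bpolys_def by (auto simp: lookup_add dest!: bspec spec[of _ i])
  ultimately have "lookup (var_poly i ^ n * h + g) ?m = lookup h m"
    by (simp add: lookup_add in_keys_iff)
  with assms(3) m show False by (simp add: in_keys_iff)
qed

lemma bpolys_degree_bound: "f \<in> bpolys (S(i := UNIV)) \<Longrightarrow> \<exists>n. f \<in> bpolys (S(i := {..<n}))"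
proof (induction f rule: bpolys_induct)
  case (single m c)
  then show ?case by (intro exI[of _ "Suc (lookup m i)"] bpolys_single) (auto split: if_splits)
next
  case (add f g)
  then obtain n n' where "f \<in> bpolys (S(i := {..<n}))" "g \<in> bpolys (S(i := {..<n'}))" by blast
  then have "f \<in> bpolys (S(i := {..<max n n'}))" "g \<in> bpolys (S(i := {..<max n n'}))"
    by (auto elim!: bpolys_mono)
  then show ?case by (blast intro: bpolys_add)
qed auto

text \<open>The lower coefficients involve only variables from \<open>U\<close>, so multiplying by q
  respects exponent restrictions on all variables outside \<open>U\<close> other than i. For
  \<open>D = 0\<close> the only possibility is q = 1, which is the head of a cycle without private
  elements.\<close>

definition monic_in :: "nat set \<Rightarrow> nat \<Rightarrow> nat \<Rightarrow> ('k::comm_ring_1) mpoly \<Rightarrow> bool" where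
  "monic_in U i D q \<longleftrightarrow> (\<exists>q'\<in>bpolys ((vars_bound U)(i := {..<D})). q = var_poly i ^ D + q')"

lemma vars_monic_in: "monic_in U i D q \<Longrightarrow> poly_in_vars (insert i U) q"
  unfolding monic_in_def by (auto intro!: vars_add vars_power) 
    (auto simp: poly_in_vars_iff vars_bound_def elim!: bpolys_mono)

lemma monic_in_lower_mult:
  assumes "q' \<in> bpolys ((vars_bound U)(i := {..<D}))" "i \<notin> U" "\<forall>l\<in>U. T l = UNIV" 
    "g \<in> bpolys (T(i := {..<n}))"
  shows "q' * g \<in> bpolys (T(i := {..<D + n - 1}))"
  by (rule bpolys_mult[OF assms(1,4)]) (use assms(2,3) in \<open>auto simp: vars_bound_def split: if_splits\<close>)

lemma monic_division_step:
  assumes "q' \<in> bpolys ((vars_bound U)(i := {..<D}))" "i \<notin> U" "\<forall>l\<in>U. T l = UNIV" 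
    "h \<in> bpolys (T(i := {0}))" "n \<ge> D"
  shows "q' * (var_poly i ^ (n - D) * h) \<in> bpolys (T(i := {..<n}))"
proof -
  have "var_poly i ^ (n - D) * h \<in> bpolys (T(i := {..<Suc (n - D)}))"
    by (rule bpolys_mult[OF bpolys_var_power[of "n - D" "(\<lambda>_. {0})(i := {n - D})"] assms(4)])
      (auto split: if_splits)
  from monic_in_lower_mult[OF assms(1-3) this] show ?thesis
    using assms(5) by (simp)
qed

text \<open>Long division by degree in variable i. Quotient and remainder keep the restrictions
  \<open>T\<close> on the other variables, since \<open>T\<close> is unrestricted where q has
  coefficients.\<close>

lemma monic_division:
  assumes q: "monic_in U i D q" and U: "i \<notin> U" "\<forall>l\<in>U. T l = UNIV" 
    and f: "f \<in> bpolys (T(i := UNIV))"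
  shows "\<exists>g\<in>bpolys (T(i := UNIV)). \<exists>r\<in>bpolys (T(i := {..<D})). f = q * g + r"
proof -
  obtain q' where q': "q'\<in>bpolys ((vars_bound U)(i := {..<D}))" "q = var_poly i ^ D + q'"
    using q by (auto simp: monic_in_def)
  have "\<exists>g\<in>bpolys (T(i := UNIV)). \<exists>r\<in>bpolys (T(i := {..<D})). f = q * g + r"
    if "f \<in> bpolys (T(i := {..<n}))" for n
    using that
  proof (induction n arbitrary: f)
    case 0
    then have "f \<in> bpolys (T(i := {..<D}))" by (auto elim!: bpolys_mono)
    then show ?case by - (rule bexI[of _ 0], rule bexI[of _ f], auto simp del: fun_upd_apply)
  next
    case (Suc n)
    show ?case
    proof (cases "Suc n \<le> D")
      case True
      with Suc.prems have "f \<in> bpolys (T(i := {..<D}))" by (auto elim!: bpolys_mono)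
      then show ?thesis by - (rule bexI[of _ 0], rule bexI[of _ f], auto simp del: fun_upd_apply)
    next
      case False
      then have D: "D \<le> n" by simp
      have "f \<in> bpolys (T(i := {..n}))" using Suc.prems unfolding lessThan_Suc_atMost .
      then obtain h f' where h: "h\<in>bpolys (T(i := {0}))" and f': "f'\<in>bpolys (T(i := {..<n}))" 
        and f: "f = var_poly i ^ n * h + f'"
        using bpolys_split by blast
      \<comment> \<open>Subtracting \<open>q * ?k\<close> cancels the leading term and leaves
        \<open>f' - q' * ?k\<close>, which has degree below n.\<close>
      let ?k = "var_poly i ^ (n - D) * h"
      have "f' - q' * ?k \<in> bpolys (T(i := {..<n}))"
        using monic_division_step[OF q'(1) U h D] f' by (auto intro: bpolys_diff)
      then obtain g r where g: "g\<in>bpolys (T(i := UNIV))" "r\<in>bpolys (T(i := {..<D}))" "f' - q' * ?k = q * g + r"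
        using Suc.IH by blast
      have "var_poly i ^ n = (var_poly i ^ D * var_poly i ^ (n - D) :: 'a mpoly)"
        using D by (simp flip: power_add)
      then have "f = q * (g + ?k) + r" using g(3) unfolding f q'(2) by (simp add: algebra_simps)
      moreover have "?k \<in> bpolys (T(i := UNIV))"
        by (rule bpolys_mult[OF bpolys_var_power[of "n - D" "(\<lambda>_. {0})(i := {n - D})"] h]) (auto split: if_splits)
      ultimately show ?thesis using g(1,2) by (blast intro: bpolys_add)
    qed
  qed
  then show ?thesis using bpolys_degree_bound[OF f] by blast
qed

text \<open>The coefficient of degree n in \<open>g\<close> reappears as the coefficient of degree n
  + D in \<open>q * g + r\<close>; everything else has lower degree. So the degree bound on
  \<open>g\<close> can be lowered until \<open>g\<close> is zero.\<close>

lemma monic_division_unique: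
  assumes q: "monic_in U i D q" and U: "i \<notin> U" "\<forall>l\<in>U. T l = UNIV"
    and g: "g \<in> bpolys (T(i := UNIV))" and r: "r \<in> bpolys (T(i := {..<D}))" and eq: "q * g + r = 0"
  shows "g = 0" and "r = 0"
proof -
  obtain q' where q': "q'\<in>bpolys ((vars_bound U)(i := {..<D}))" "q = var_poly i ^ D + q'"
    using q by (auto simp: monic_in_def)
  have "g = 0" if "g \<in> bpolys (T(i := {..<n}))" "q * g + r = 0" for n
    using that
  proof (induction n arbitrary: g)
    case 0
    then have "m \<notin> keys g" for m by (auto simp: bpolys_def dest!: bspec[of _ _ m] spec[of _ i])
    then show ?case by (metis ex_in_conv keys_eq_empty)
  next
    case (Suc n)
    have "g \<in> bpolys (T(i := {..n}))" using Suc.prems(1) unfolding lessThan_Suc_atMost .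
    then obtain h g' where h: "h\<in>bpolys (T(i := {0}))" and g': "g'\<in>bpolys (T(i := {..<n}))" 
        and g: "g = var_poly i ^ n * h + g'"
      using bpolys_split by blast
    have 1: "q' * (var_poly i ^ (n + D - D) * h) \<in> bpolys (T(i := {..<n + D}))"
      by (rule monic_division_step[OF q'(1) U h]) simp
    have 2: "q' * g' \<in> bpolys (T(i := {..<n + D}))"
      using monic_in_lower_mult[OF q'(1) U g'] by (rule bpolys_mono) auto
    have 3: "var_poly i ^ D * g' \<in> bpolys (T(i := {..<n + D}))"
      by (rule bpolys_mult[OF bpolys_var_power[of D "(\<lambda>_. {0})(i := {D})"] g']) (auto split: if_splits)
    have 4: "r \<in> bpolys (T(i := {..<n + D}))" using r by (rule bpolys_mono) auto
    let ?low = "q' * (var_poly i ^ (n + D - D) * h) + (q' * g' + (var_poly i ^ D * g' + r))"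
    have "var_poly i ^ (n + D) * h + ?low = q * g + r"
      unfolding g q'(2) by (simp add: algebra_simps power_add)
    then have "h = 0" using Suc.prems(2) 
      by (intro bpolys_split_unique[OF h, of ?low T "n + D"]) (auto intro: bpolys_add 1[simplified] 2 3 4)
    then show ?case using Suc.IH[OF g'] Suc.prems(2) g by simp
  qed
  then show "g = 0" using bpolys_degree_bound[OF g] eq by blast
  then show "r = 0" using eq by simp
qed

subsection \<open>The quotient ring of a chain of cycles\<close>

context
  fixes t :: nat and s :: "nat \<Rightarrow> nat"
begin

text \<open>The part of the broken circuit of the interval from a to b that comes from the cycles
  after a and from the right end p_{b+1}.\<close>

definition chain_tail :: "nat \<Rightarrow> nat \<Rightarrow> ('k::comm_ring_1) mpoly" where
  "chain_tail a b = (\<Prod>l\<in>{a<..b}. var_poly l ^ s l) * (if b < t then var_poly (b + 1) - var_poly b else 1)"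

text \<open>The part contributed by p_a and the private elements of cycle a, without the minimal
  element. If there are no private elements, the minimal element is p_a and nothing remains.\<close>

definition chain_head :: "nat \<Rightarrow> ('k::comm_ring_1) mpoly" where
  "chain_head a = (if s a = 0 then 1 else (var_poly a - var_poly (a - 1)) * var_poly a ^ (s a - 1))"

definition chain_gens :: "nat \<Rightarrow> ('k::comm_ring_1) mpoly \<Rightarrow> 'k mpoly set" where
  "chain_gens i q = {q * chain_tail i b | b. i \<le> b \<and> b \<le> t} \<union>
     {chain_head a * chain_tail a b | a b. i < a \<and> a \<le> b \<and> b \<le> t}"

text \<open>Below t the bound is weak because cycle l also shares p_{l+1} with its successor; cycle
  t has no successor, and its bound is strict.\<close>

definition chain_box :: "nat set \<Rightarrow> nat \<Rightarrow> nat \<Rightarrow> nat \<Rightarrow> nat set" where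
  "chain_box U i D l = (let d = if l = i then D else s l in
     if l \<in> U then UNIV else if l < i \<or> t < l then {0} else if l = t then {..<d} else {..d})"

lemma vars_chain_tail:
  assumes "a \<le> b" "b \<le> t" "{a..t} \<subseteq> V"
  shows "poly_in_vars V (chain_tail a b)"
proof -
  have "l \<in> V" if "a \<le> l" "l \<le> t" for l using assms(3) that by auto
  then show ?thesis using assms(1,2)
    unfolding chain_tail_def by (auto intro!: vars_mult vars_prod vars_power vars_diff)
qed

text \<open>For b > i the tails at i are thus generators at i + 1 with a pure power as head, which
  is where the second use of the induction hypothesis gets its q.\<close>

lemma chain_tail_Suc: "i < b \<Longrightarrow> chain_tail i b = var_poly (Suc i) ^ s (Suc i) * chain_tail (Suc i) b"
proof -
  assume "i < b"
  then have "{i<..b} = insert (Suc i) {Suc i<..b}" by auto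
  then show ?thesis by (simp add: chain_tail_def mult.assoc)
qed

text \<open>The coefficients involve y_i, so the first use of the induction hypothesis moves i into
  the set of unrestricted variables.\<close>

lemma monic_in_chain_head: "monic_in (insert i U) (Suc i) (s (Suc i)) (chain_head (Suc i))"
proof (cases "s (Suc i)")
  case 0
  then show ?thesis by (auto simp: monic_in_def chain_head_def intro!: bexI[of _ 0])
next
  case (Suc d)
  have "- (var_poly i * var_poly (Suc i) ^ d) \<in> bpolys ((vars_bound (insert i U))(Suc i := {..<Suc d}))"
    by (intro bpolys_uminus, rule bpolys_mult[OF bpolys_var[of "(\<lambda>_. {0})(i := {1})"] 
        bpolys_var_power[of d "(\<lambda>_. {0})(Suc i := {d})"]])
      (auto simp: vars_bound_def split: if_splits)
  then show ?thesis unfolding monic_in_def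
    by (intro bexI[of _ "- (var_poly i * var_poly (Suc i) ^ d)"]) (auto simp: chain_head_def Suc algebra_simps)
qed

lemma monic_in_var_power: "monic_in U i d (var_poly i ^ d)"
  unfolding monic_in_def by (auto intro!: bexI[of _ 0])

text \<open>Write \<open>F\<close> for the ring modulo the generators that do not involve \<open>q\<close>; by induction it is free
  over the polynomials in \<open>y\<^sub>i\<close>, with the monomials of the smaller box as basis. The remaining
  generators span \<open>q N\<close> for a submodule \<open>N\<close> of \<open>F\<close>, and \<open>F / N\<close>, where \<open>y\<^sub>i = y\<^sub>i\<^sub>+\<^sub>1\<close>, has by induction
  the same monomials as basis over the coefficient ring. If \<open>W\<close> is their span, then
  \<open>F = q F \<oplus> (\<Oplus>\<^sub>j\<^sub><\<^sub>D y\<^sub>i\<^sup>j W) = q N \<oplus> q W \<oplus> (\<Oplus>\<^sub>j\<^sub><\<^sub>D y\<^sub>i\<^sup>j W)\<close>.\<close>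

theorem chain_decomposition:
  fixes q :: "('k::comm_ring_1) mpoly"
  assumes "i \<le> t" "U \<inter> {i..t} = {}" "monic_in U i D q"
  shows "\<forall>f. poly_in_vars (U \<union> {i..t}) f \<longrightarrow>
           (\<exists>w\<in>bpolys (chain_box U i D). f - w \<in> ideal_gen (U \<union> {i..t}) (chain_gens i q))"
    and "\<forall>w\<in>bpolys (chain_box U i D). w \<in> ideal_gen (U \<union> {i..t}) (chain_gens i q) \<longrightarrow> w = 0"
proof -
  have "(\<forall>f. poly_in_vars (U \<union> {i..t}) f \<longrightarrow>
           (\<exists>w\<in>bpolys (chain_box U i D). f - w \<in> ideal_gen (U \<union> {i..t}) (chain_gens i q)))
     \<and> (\<forall>w\<in>bpolys (chain_box U i D). w \<in> ideal_gen (U \<union> {i..t}) (chain_gens i q) \<longrightarrow> w = 0)"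
    using assms
  proof (induction i arbitrary: U D q rule: inc_induct)
    case base
    let ?T = "vars_bound (insert t U)" and ?V = "U \<union> {t..t}"
    have V: "?V = insert t U" by auto
    have box: "chain_box U t D = ?T(t := {..<D})"
      using base by (auto simp: chain_box_def vars_bound_def fun_eq_iff Let_def)
    have T: "?T(t := UNIV) = ?T" by (auto simp: vars_bound_def fun_eq_iff)
    have U: "t \<notin> U" "\<forall>l\<in>U. ?T l = UNIV" using base by (auto simp: vars_bound_def)
    have gens: "chain_gens t q = {q}" by (auto simp: chain_gens_def chain_tail_def)
    have id: "f \<in> ideal_gen ?V {q} \<Longrightarrow> \<exists>g. poly_in_vars ?V g \<and> f = g * q" for f
    proof (induction f rule: ideal_gen_induct)
      case (add f g)
      then show ?case by (metis distrib_right vars_add)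
    qed (auto intro: exI[of _ 0])
    show ?case unfolding gens
    proof (intro conjI allI impI ballI)
      fix f :: "'k mpoly" assume "poly_in_vars ?V f"
      then obtain g r where g: "g \<in> bpolys ?T" "r \<in> bpolys (?T(t := {..<D}))" "f = q * g + r"
        using monic_division[OF base(2) U, of f] unfolding T V poly_in_vars_iff by auto
      have "f - r \<in> ideal_gen ?V {q}"
        using g ideal_gen_mult[OF ideal_gen_gen, of q "{q}" ?V g] by (simp add: poly_in_vars_iff V mult.commute)
      then show "\<exists>w\<in>bpolys (chain_box U t D). f - w \<in> ideal_gen ?V {q}" using g(2) box by auto
    next
      fix w :: "'k mpoly" assume w: "w \<in> bpolys (chain_box U t D)" "w \<in> ideal_gen ?V {q}"
      then obtain g where g: "poly_in_vars ?V g" "w = g * q" using id by blast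
      have "q * g + (- w) = 0" using g by (simp add: mult.commute)
      then show "w = 0" using monic_division_unique(2)[OF base(2) U, of g "- w"] w(1) g(1)
        unfolding T box V poly_in_vars_iff by (auto simp: bpolys_uminus)
    qed
  next
    case (step i)
    let ?j = "Suc i"
    let ?V = "U \<union> {i..t}" and ?V' = "U \<union> {?j..t}"
    have V: "insert i U \<union> {?j..t} = ?V" using step.hyps by auto
    have iU: "i \<notin> U" using step.prems step.hyps by auto
    define T where "T = chain_box (insert i U) ?j (s ?j)"
    have Ti: "T(i := UNIV) = T" by (auto simp: T_def chain_box_def fun_eq_iff)
    have W: "chain_box U i D = T(i := {..D})"
      using step.prems step.hyps by (auto simp: T_def chain_box_def fun_eq_iff Let_def)
    have W2: "chain_box U ?j (s ?j) = T(i := {0})"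
      using step.prems step.hyps by (auto simp: T_def chain_box_def fun_eq_iff Let_def)
    have TU: "\<forall>l\<in>U. T l = UNIV" by (auto simp: T_def chain_box_def)
    \<comment> \<open>In the notation above, \<open>J2\<close> is the ideal of relations of F,
      \<open>N\<close> is the preimage of the submodule N, and \<open>J3\<close> presents F / N
      after y_i has been eliminated.\<close>
    define J2 where "J2 = ideal_gen ?V (chain_gens ?j (chain_head ?j :: 'k mpoly))"
    define J3 where "J3 = ideal_gen ?V' (chain_gens ?j (var_poly ?j ^ s ?j :: 'k mpoly))"
    define J where "J = ideal_gen ?V (chain_gens i q)"
    define N where "N = ideal_gen ?V (chain_gens ?j (chain_head ?j) \<union> {chain_tail i b | b. i \<le> b \<and> b \<le> t} :: 'k mpoly set)"
    have d1: "insert i U \<inter> {?j..t} = {}" and d2: "U \<inter> {?j..t} = {}" using step.prems by auto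
    have IH1: "poly_in_vars ?V f \<Longrightarrow> \<exists>w\<in>bpolys T. f - w \<in> J2"
      "w \<in> bpolys T \<Longrightarrow> w \<in> J2 \<Longrightarrow> w = 0" for f w
      using step.IH[OF d1 monic_in_chain_head[of i U]] unfolding V T_def J2_def by auto
    have IH2: "poly_in_vars ?V' f \<Longrightarrow> \<exists>w\<in>bpolys (T(i := {0})). f - w \<in> J3"
      "w \<in> bpolys (T(i := {0})) \<Longrightarrow> w \<in> J3 \<Longrightarrow> w = 0" for f w
      using step.IH[OF d2 monic_in_var_power[of U ?j "s ?j"]] unfolding W2 J3_def by blast+
    have qV: "poly_in_vars ?V q"
      using vars_monic_in[OF step.prems(2)] by (rule vars_mono) (use step.hyps in auto)
    have gens: "chain_gens i q = chain_gens ?j (chain_head ?j) \<union> {q * chain_tail i b | b. i \<le> b \<and> b \<le> t}"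
    proof -
      have "i < a \<longleftrightarrow> a = ?j \<or> ?j < a" for a by auto
      then have "{chain_head a * chain_tail a b :: 'k mpoly | a b. i < a \<and> a \<le> b \<and> b \<le> t}
          = {chain_head ?j * chain_tail ?j b | b. ?j \<le> b \<and> b \<le> t}
          \<union> {chain_head a * chain_tail a b | a b. ?j < a \<and> a \<le> b \<and> b \<le> t}"
        by (simp only: conj_disj_distribL conj_disj_distribR ex_disj_distrib Collect_disj_eq) auto
      then show ?thesis unfolding chain_gens_def by (simp only: Un_ac)
    qed
    have J2J: "f \<in> J" if "f \<in> J2" for f
      using that unfolding J2_def
      by (induction f rule: ideal_gen_induct)
        (auto simp: J_def gens intro!: ideal_gen_add ideal_gen_mult[OF ideal_gen_gen])
    have J2N: "f \<in> N" if "f \<in> J2" for f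
      using that unfolding J2_def
      by (induction f rule: ideal_gen_induct)
        (auto simp: N_def intro!: ideal_gen_add ideal_gen_mult[OF ideal_gen_gen])
    have qN: "q * f \<in> J" if "f \<in> N" for f
      using that unfolding N_def
    proof (induction f rule: ideal_gen_induct)
      case (gen c g)
      then show ?case
      proof (elim UnE)
        assume "g \<in> chain_gens ?j (chain_head ?j)"
        then have "(q * c) * g \<in> J" using gen(2) qV
          unfolding J_def gens by (intro ideal_gen_mult[OF ideal_gen_gen]) auto
        then show ?thesis by (simp add: mult.assoc)
      next
        assume "g \<in> {chain_tail i b |b. i \<le> b \<and> b \<le> t}"
        then have "c * (q * g) \<in> J" using gen(2)
          unfolding J_def gens by (intro ideal_gen_mult[OF ideal_gen_gen]) auto
        then show ?thesis by (simp add: algebra_simps)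
      qed
    next
      case (add f g)
      then show ?case unfolding J_def by (simp add: distrib_left ideal_gen_add)
    qed (simp add: J_def)
    have Jsplit: "\<exists>j n. j \<in> J2 \<and> n \<in> N \<and> poly_in_vars ?V n \<and> f = j + q * n" if "f \<in> J" for f
      using that unfolding J_def
    proof (induction f rule: ideal_gen_induct)
      case (gen c g)
      from gen(1) show ?case unfolding gens
      proof (elim UnE)
        assume "g \<in> chain_gens ?j (chain_head ?j)"
        then show ?thesis using gen(2)
          by - (rule exI[of _ "c * g"], rule exI[of _ 0], auto simp: J2_def N_def intro!: ideal_gen_mult[OF ideal_gen_gen])
      next
        assume "g \<in> {q * chain_tail i b |b. i \<le> b \<and> b \<le> t}"
        then obtain b where b: "g = q * chain_tail i b" "i \<le> b" "b \<le> t" by auto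
        have "c * chain_tail i b \<in> N" unfolding N_def
          by (intro ideal_gen_mult[OF ideal_gen_gen]) (use b gen(2) in auto)
        then show ?thesis using gen(2) b
          by - (rule exI[of _ 0], rule exI[of _ "c * chain_tail i b"], auto simp: J2_def algebra_simps intro!: vars_mult vars_chain_tail)
      qed
    next
      case zero
      show ?case by (intro exI[of _ 0]) (auto simp: J2_def N_def)
    next
      case (add f g)
      then obtain j n j' n' where "j \<in> J2" "n \<in> N" "poly_in_vars ?V n" "f = j + q * n"
        "j' \<in> J2" "n' \<in> N" "poly_in_vars ?V n'" "g = j' + q * n'" by blast
      then show ?case by - (rule exI[of _ "j + j'"], rule exI[of _ "n + n'"], auto simp: J2_def N_def algebra_simps intro: ideal_gen_add)
    qed
    \<comment> \<open>Replacing y_i by y_{i+1} retracts onto the polynomials without y_i. It maps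
      \<open>N\<close> into \<open>J3\<close> and changes a polynomial only by an element of
      \<open>N\<close>.\<close>
    define h where "h l = (if l = i then var_poly ?j else var_poly l :: 'k mpoly)" for l
    have hV: "poly_in_vars ?V' (h l)" if "l \<in> ?V" for l
      using that step.hyps by (auto simp: h_def)
    have h_id: "psubst h f = f" if "poly_in_vars ?V' f" for f
      using that by (rule psubst_id) (use iU in \<open>auto simp: h_def\<close>)
    have diffN: "var_poly ?j - var_poly i \<in> N"
      unfolding N_def using step.hyps by (intro ideal_gen_gen UnI2 CollectI exI[of _ i]) (auto simp: chain_tail_def)
    have J3N: "f \<in> N" if "f \<in> J3" for f
      using that unfolding J3_def
    proof (induction f rule: ideal_gen_induct)
      case (gen c g)
      have c: "poly_in_vars ?V c" using gen(2) by (rule vars_mono) auto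
      from gen(1) have "g \<in> N" unfolding chain_gens_def
      proof (elim UnE)
        assume "g \<in> {var_poly ?j ^ s ?j * chain_tail ?j b |b. ?j \<le> b \<and> b \<le> t}"
        then obtain b where b: "g = var_poly ?j ^ s ?j * chain_tail ?j b" "?j \<le> b" "b \<le> t" by auto
        then have "g = chain_tail i b" by (simp add: chain_tail_Suc)
        with b(2,3) show ?thesis unfolding N_def by (intro ideal_gen_gen) auto
      next
        assume "g \<in> {chain_head a * chain_tail a b |a b. ?j < a \<and> a \<le> b \<and> b \<le> t}"
        then show ?thesis unfolding N_def by (intro ideal_gen_gen UnI1) (auto simp: chain_gens_def)
      qed
      then show ?case using c by (auto simp: N_def intro: ideal_gen_mult)
    qed (auto simp: N_def intro: ideal_gen_add)
    have hN: "psubst h f \<in> J3" if "f \<in> N" for f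
      using that unfolding N_def
    proof (induction f rule: ideal_gen_induct)
      case (gen c g)
      have c: "poly_in_vars ?V' (psubst h c)" using gen(2) hV by (rule psubst_vars)
      have tail: "poly_in_vars ?V' (chain_tail a b)" if "?j \<le> a" "a \<le> b" "b \<le> t" for a b
        using that by (intro vars_chain_tail) auto
      have J3_tail: "var_poly ?j ^ s ?j * chain_tail ?j b \<in> J3" if "?j \<le> b" "b \<le> t" for b
        unfolding J3_def by (rule ideal_gen_gen) (use that in \<open>auto simp: chain_gens_def\<close>)
      from gen(1) have "psubst h g \<in> J3"
      proof (elim UnE)
        assume "g \<in> chain_gens ?j (chain_head ?j)"
        then consider b where "g = chain_head ?j * chain_tail ?j b" "?j \<le> b" "b \<le> t"
          | a b where "g = chain_head a * chain_tail a b" "?j < a" "a \<le> b" "b \<le> t"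
          unfolding chain_gens_def by auto
        then show ?thesis
        proof cases
          case 1
          \<comment> \<open>The factor y_{i+1} - y_i of the head vanishes. If
            \<open>s ?j = 0\<close> the head is 1, which is the zeroth power heading the generators
            of \<open>J3\<close>.\<close>
          have "psubst h (chain_head ?j) = (if s ?j = 0 then 1 else 0 :: 'k mpoly)"
            by (simp add: chain_head_def psubst_simps) (simp add: h_def)
          then show ?thesis using J3_tail[OF 1(2,3)] 1 by (auto simp: psubst_mult h_id tail J3_def)
        next
          case 2
          have "poly_in_vars ?V' (chain_head a :: 'k mpoly)"
            using 2 by (auto simp: chain_head_def intro!: vars_mult vars_diff vars_power)
          then have "psubst h g = g" using 2 by (intro h_id) (auto intro!: vars_mult tail)
          then show ?thesis unfolding J3_def using 2
            by (auto simp: chain_gens_def intro!: ideal_gen_gen)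
        qed
      next
        assume "g \<in> {chain_tail i b |b. i \<le> b \<and> b \<le> t}"
        then obtain b where b: "g = chain_tail i b" "i \<le> b" "b \<le> t" by auto
        show ?thesis
        proof (cases "b = i")
          case True
          then show ?thesis using b step.hyps by (auto simp: chain_tail_def psubst_simps h_def J3_def)
        next
          case False
          then have "psubst h g = var_poly ?j ^ s ?j * chain_tail ?j b"
            using b by (subst h_id) (auto simp: chain_tail_Suc intro!: vars_mult vars_power tail)
          then show ?thesis using J3_tail[of b] False b by simp
        qed
      qed
      then show ?case using c by (auto simp: psubst_mult J3_def intro: ideal_gen_mult)
    qed (auto simp: J3_def psubst_add intro: ideal_gen_add)
    have W2V: "poly_in_vars ?V' w" if "w \<in> bpolys (T(i := {0}))" for w :: "'k mpoly"
      using that unfolding poly_in_vars_iff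
      by (rule bpolys_mono) (auto simp: T_def chain_box_def vars_bound_def)
    have TV: "poly_in_vars ?V w" if "w \<in> bpolys T" for w :: "'k mpoly"
      using that unfolding poly_in_vars_iff
      by (rule bpolys_mono) (use step.hyps in \<open>auto simp: T_def chain_box_def vars_bound_def\<close>)
    obtain q' where q': "q'\<in>bpolys ((vars_bound U)(i := {..<D}))" "q = var_poly i ^ D + q'"
      using step.prems(2) by (auto simp: monic_in_def)
    have q'mult: "q' * w \<in> bpolys (T(i := {..<D}))" if "w \<in> bpolys (T(i := {0}))" for w
      using monic_division_step[OF q'(1) iU TU that, of D] by simp
    have pmult: "var_poly i ^ D * w \<in> bpolys (T(i := {..D}))" if "w \<in> bpolys (T(i := {0}))" for w
      by (rule bpolys_mult[OF bpolys_var_power[of D "(\<lambda>_. {0})(i := {D})"] that]) (auto split: if_splits)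
    have WD: "w \<in> bpolys (T(i := {..D}))" if "w \<in> bpolys (T(i := {..<D}))" for w :: "'k mpoly"
      using that by (rule bpolys_mono) auto
    show ?case unfolding J_def[symmetric] W
    proof (intro conjI allI impI ballI)
      fix f :: "'k mpoly" assume f: "poly_in_vars ?V f"
      then obtain w where w: "w \<in> bpolys T" "f - w \<in> J2" using IH1 by blast
      \<comment> \<open>This is F = q F plus lower powers of y_i. The quotient g is then reduced
        modulo \<open>N\<close> to some v free of y_i, which is harmless because q N lies in
        \<open>J\<close>.\<close>
      then obtain g r where g: "g \<in> bpolys T" "r \<in> bpolys (T(i := {..<D}))" "w = q * g + r"
        using monic_division[OF step.prems(2) iU TU, of w] unfolding Ti by auto
      have gV: "poly_in_vars ?V g" using g(1) by (rule TV)
      have "poly_in_vars ?V' (psubst h g)" by (rule psubst_vars[OF gV hV])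
      then obtain v where v: "v \<in> bpolys (T(i := {0}))" "psubst h g - v \<in> J3" using IH2 by blast
      have "g - psubst h g \<in> N" unfolding N_def
      proof (rule psubst_diff_in_ideal[OF gV])
        fix l assume "l \<in> ?V"
        then show "poly_in_vars ?V (h l)" by (intro vars_mono[OF hV]) auto
        show "var_poly l - h l \<in> ideal_gen ?V (chain_gens ?j (chain_head ?j) \<union> {chain_tail i b |b. i \<le> b \<and> b \<le> t})"
          using ideal_gen_uminus[OF diffN[unfolded N_def]] by (auto simp: h_def)
      qed
      then have "(g - psubst h g) + (psubst h g - v) \<in> N"
        using J3N[OF v(2)] unfolding N_def by (rule ideal_gen_add)
      then have "q * (g - v) \<in> J" using qN by simp
      then have "(f - w) + q * (g - v) \<in> J"
        using J2J[OF w(2)] unfolding J_def by (blast intro: ideal_gen_add)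
      moreover have "(f - w) + q * (g - v) = f - (q * v + r)" using g(3) by (simp add: algebra_simps)
      moreover have "q * v + r \<in> bpolys (T(i := {..D}))"
        using v(1) g(2) unfolding q'(2) distrib_right by (intro bpolys_add pmult WD q'mult)
      ultimately show "\<exists>w\<in>bpolys (T(i := {..D})). f - w \<in> J" by auto
    next
      fix w :: "'k mpoly" assume w: "w \<in> bpolys (T(i := {..D}))" "w \<in> J"
      then obtain u r where u: "u \<in> bpolys (T(i := {0}))" "r \<in> bpolys (T(i := {..<D}))" "w = var_poly i ^ D * u + r"
        using bpolys_split by blast
      obtain j n where jn: "j \<in> J2" "n \<in> N" "poly_in_vars ?V n" "w = j + q * n" using Jsplit w(2) by blast
      obtain v where v: "v \<in> bpolys T" "n - v \<in> J2" using IH1 jn(3) by blast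
      have uT: "u \<in> bpolys T" using u(1) by (rule bpolys_mono) (auto simp: T_def chain_box_def)
      have r': "r - q' * u \<in> bpolys (T(i := {..<D}))" using u q'mult by (intro bpolys_diff)
      then have r'T: "r - q' * u \<in> bpolys T" by (rule bpolys_mono) (auto simp: T_def chain_box_def)
      \<comment> \<open>Since y_i^D = q - q', the polynomial w is q u + (r - q' u). The left side
        obeys the exponent bounds \<open>T\<close> and the right side lies in \<open>J2\<close>, so
        both vanish, and uniqueness of division by q yields v = u.\<close>
      have eq: "q * (u - v) + (r - q' * u) = j + q * (n - v)"
        using jn(4) u(3) unfolding q'(2) by (simp add: algebra_simps)
      have "j + q * (n - v) \<in> J2" 
        using jn(1) v(2) qV unfolding J2_def by (intro ideal_gen_add ideal_gen_mult)
      moreover have "q * (u - v) + (r - q' * u) \<in> bpolys T"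
      proof (rule bpolys_add[OF _ r'T], rule bpolys_mult)
        show "q \<in> bpolys (vars_bound (insert i U))" using vars_monic_in[OF step.prems(2)] by (simp add: poly_in_vars_iff)
        show "u - v \<in> bpolys T" using uT v(1) by (rule bpolys_diff)
      qed (auto simp: vars_bound_def T_def chain_box_def split: if_splits)
      ultimately have "q * (u - v) + (r - q' * u) = 0" using IH1(2) eq by simp
      then have "u - v = 0" "r - q' * u = 0"
        using monic_division_unique[OF step.prems(2) iU TU, of "u - v" "r - q' * u"] r' bpolys_diff[OF uT v(1)]
        unfolding Ti by auto
      then have uv: "v = u" and r: "r = q' * u" by auto
      have "n - u \<in> N" using J2N v(2) uv by simp
      \<comment> \<open>Hence u lies in \<open>N\<close>. It is free of y_i, so the substitution
        fixes it and places it in \<open>J3\<close>, where the induction hypothesis forces u =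
        0.\<close>
      with jn(2) have "n - (n - u) \<in> N" unfolding N_def by (rule ideal_gen_diff)
      then have "u \<in> J3" using hN[of u] h_id W2V u(1) by simp
      then have "u = 0" using IH2(2) u(1) by blast
      then show "w = 0" using u(3) r by simp
    qed
  qed
  then show "\<forall>f. poly_in_vars (U \<union> {i..t}) f \<longrightarrow>
           (\<exists>w\<in>bpolys (chain_box U i D). f - w \<in> ideal_gen (U \<union> {i..t}) (chain_gens i q))"
    and "\<forall>w\<in>bpolys (chain_box U i D). w \<in> ideal_gen (U \<union> {i..t}) (chain_gens i q) \<longrightarrow> w = 0"
    by blast+
qed

end

subsection \<open>Matroids with signed circuits\<close>

text \<open>\<open>Z\<close> is an integral cycle lattice, and it replaces circuit elimination by
  linear algebra: cycles may be subtracted with integer factors, and the support of a nonzero cycle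
  contains a circuit. Signs are their own inverses, so every elimination stays over the
  integers.\<close>

locale signed_circuits =
  fixes N :: "'a matroid" and sg :: "'a set \<Rightarrow> 'a \<Rightarrow> int" and Z :: "('a \<Rightarrow> int) set"
  assumes finite_gnd: "finite (gnd N)"
    and circuit_subset: "C \<in> circuits N \<Longrightarrow> C \<subseteq> gnd N"
    and circuit_nonempty: "C \<in> circuits N \<Longrightarrow> C \<noteq> {}"
    and sign_in: "C \<in> circuits N \<Longrightarrow> x \<in> C \<Longrightarrow> sg C x \<in> {1, -1}"
    and sign_out: "C \<in> circuits N \<Longrightarrow> x \<notin> C \<Longrightarrow> sg C x = 0"
    and sg_cycle: "C \<in> circuits N \<Longrightarrow> sg C \<in> Z"
    and cycle_diff: "z \<in> Z \<Longrightarrow> z' \<in> Z \<Longrightarrow> (\<lambda>x. z x - c * z' x) \<in> Z"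
    and cycle_out: "z \<in> Z \<Longrightarrow> x \<notin> gnd N \<Longrightarrow> z x = 0"
    and cycle_support: "z \<in> Z \<Longrightarrow> z x \<noteq> 0 \<Longrightarrow> \<exists>C\<in>circuits N. \<forall>y\<in>C. z y \<noteq> 0"
begin

lemma sign_square: "C \<in> circuits N \<Longrightarrow> x \<in> C \<Longrightarrow> sg C x * sg C x = 1"
  using sign_in[of C x] by auto

lemma sign_nonzero_iff: "C \<in> circuits N \<Longrightarrow> sg C x \<noteq> 0 \<longleftrightarrow> x \<in> C"
  using sign_in[of C x] sign_out[of C x] by auto

lemma indep_empty: "indep N {}"
  using circuit_nonempty by (auto simp: indep_def)

lemma indep_mono: "indep N I \<Longrightarrow> J \<subseteq> I \<Longrightarrow> indep N J"
  unfolding indep_def by blast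

lemma indep_finite: "indep N I \<Longrightarrow> finite I"
  unfolding indep_def using finite_gnd finite_subset by blast

lemma maximal_indep:
  assumes "indep N I" "I \<subseteq> X" "X \<subseteq> gnd N"
  shows "\<exists>B. indep N B \<and> I \<subseteq> B \<and> B \<subseteq> X \<and> (\<forall>J. indep N J \<longrightarrow> J \<subseteq> X \<longrightarrow> B \<subseteq> J \<longrightarrow> J = B)"
proof -
  let ?F = "{J. indep N J \<and> J \<subseteq> X \<and> I \<subseteq> J}"
  have "finite ?F" using assms(3) finite_gnd by (auto intro: finite_subset[of _ "Pow (gnd N)"])
  moreover have "I \<in> ?F" using assms by auto
  ultimately obtain B where "B \<in> ?F" "\<forall>J\<in>?F. B \<subseteq> J \<longrightarrow> B = J"
    using finite_has_maximal[of ?F] by blast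
  then show ?thesis by (intro exI[of _ B]) blast
qed

lemma basis_extend: "indep N I \<Longrightarrow> \<exists>B. is_basis N B \<and> I \<subseteq> B"
  using maximal_indep[of I "gnd N"] unfolding is_basis_def indep_def by (metis order_refl)

lemma basis_circuit:
  assumes "is_basis N B" "y \<in> gnd N" "y \<notin> B"
  shows "\<exists>C\<in>circuits N. C \<subseteq> insert y B \<and> y \<in> C"
proof -
  have "\<not> indep N (insert y B)" using assms unfolding is_basis_def by blast
  moreover have "insert y B \<subseteq> gnd N" using assms by (auto simp: is_basis_def indep_def)
  ultimately obtain C where "C \<in> circuits N" "C \<subseteq> insert y B" by (auto simp: indep_def)
  moreover have "\<not> C \<subseteq> B" using calculation assms(1) by (auto simp: is_basis_def indep_def)
  ultimately show ?thesis by blast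
qed

lemma cycle_zero:
  assumes "indep N I" "z \<in> Z" "\<And>x. x \<notin> I \<Longrightarrow> z x = 0"
  shows "z x = 0"
proof (rule ccontr)
  assume "z x \<noteq> 0"
  then obtain C where "C \<in> circuits N" "\<forall>y\<in>C. z y \<noteq> 0" using cycle_support assms(2) by blast
  moreover then have "C \<subseteq> I" using assms(3) by blast
  ultimately show False using assms(1) by (auto simp: indep_def)
qed

lemma circuit_in_insert:
  assumes "C \<in> circuits N" "C \<subseteq> insert y B" "indep N B"
  shows "y \<in> C" and "y \<notin> B"
  using assms by (auto simp: indep_def)

text \<open>The combination of the two signed circuits that cancels y is a cycle supported in the
  independent set \<open>B\<close>, hence zero; so the circuits have equal supports.\<close>

lemma fund_circuit_unique:
  assumes B: "indep N B" and C: "C \<in> circuits N" "C \<subseteq> insert y B" and C': "C' \<in> circuits N" "C' \<subseteq> insert y B"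
  shows "C = C'"
proof -
  let ?z = "\<lambda>x. sg C x - (sg C y * sg C' y) * sg C' x"
  have y: "y \<in> C" "y \<in> C'" using circuit_in_insert B C C' by blast+
  have "?z x = 0" for x
  proof (rule cycle_zero[OF B cycle_diff])
    fix x assume "x \<notin> B"
    show "?z x = 0"
    proof (cases "x = y")
      case True
      then show ?thesis using sign_square[OF C'(1) y(2)] by (simp add: mult.assoc)
    next
      case False
      with \<open>x \<notin> B\<close> have "x \<notin> C" "x \<notin> C'" using C C' by auto
      then show ?thesis using sign_out C C' by simp
    qed
  qed (use sg_cycle C C' in auto)
  moreover have "sg C y * sg C' y \<noteq> 0" using sign_nonzero_iff C C' y by auto
  ultimately have "sg C x \<noteq> 0 \<longleftrightarrow> sg C' x \<noteq> 0" for x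
    by (metis diff_0_right eq_iff_diff_eq_0 mult_eq_0_iff)
  then show ?thesis using sign_nonzero_iff C C' by auto
qed

lemma fund_ci_eq:
  assumes "indep N B" "C \<in> circuits N" "C \<subseteq> insert y B"
  shows "fund_ci N B y = C"
  unfolding fund_ci_def using assms fund_circuit_unique by (intro the_equality) blast+

lemma fund_ci:
  assumes "is_basis N B" "y \<in> gnd N" "y \<notin> B"
  shows "fund_ci N B y \<in> circuits N" "fund_ci N B y \<subseteq> insert y B" "y \<in> fund_ci N B y"
proof -
  obtain C where C: "C \<in> circuits N" "C \<subseteq> insert y B" "y \<in> C" using basis_circuit[OF assms] by blast
  then have "fund_ci N B y = C" using assms(1) by (intro fund_ci_eq) (auto simp: is_basis_def)
  with C show "fund_ci N B y \<in> circuits N" "fund_ci N B y \<subseteq> insert y B" "y \<in> fund_ci N B y" by auto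
qed

lemma cycle_sum:
  assumes "z \<in> Z" "finite A" "\<And>y. y \<in> A \<Longrightarrow> w y \<in> Z"
  shows "(\<lambda>x. z x - (\<Sum>y\<in>A. c y * w y x)) \<in> Z"
  using assms(2,3)
proof (induction A rule: finite_induct)
  case (insert a A)
  then have "(\<lambda>x. (z x - (\<Sum>y\<in>A. c y * w y x)) - c a * w a x) \<in> Z"
    by (intro cycle_diff) auto
  with insert show ?case by (simp add: algebra_simps)
qed (use assms(1) in simp)

text \<open>Subtracting the fundamental circuits with these coefficients leaves a cycle that
  vanishes outside \<open>B\<close>.\<close>

lemma cycle_expand:
  assumes B: "is_basis N B" and z: "z \<in> Z"
  shows "z x = (\<Sum>y\<in>gnd N - B. z y * sg (fund_ci N B y) y * sg (fund_ci N B y) x)"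
proof -
  let ?T = "gnd N - B" and ?c = "\<lambda>y. z y * sg (fund_ci N B y) y"
  let ?z = "\<lambda>x. z x - (\<Sum>y\<in>?T. ?c y * sg (fund_ci N B y) x)"
  have "?z x = 0"
  proof (rule cycle_zero[of B])
    show "indep N B" using B by (simp add: is_basis_def)
    show "?z \<in> Z" by (rule cycle_sum[OF z]) (use finite_gnd fund_ci[OF B] sg_cycle in auto)
    fix x assume x: "x \<notin> B"
    have other: "sg (fund_ci N B y) x = 0" if "y \<in> ?T" "x \<noteq> y" for y
      using fund_ci[OF B, of y] that x by (intro sign_out) auto
    show "?z x = 0"
    proof (cases "x \<in> ?T")
      case True
      have "(\<Sum>y\<in>?T - {x}. ?c y * sg (fund_ci N B y) x) = 0"
        by (intro sum.neutral ballI) (use other in auto)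
      then have "(\<Sum>y\<in>?T. ?c y * sg (fund_ci N B y) x) = ?c x * sg (fund_ci N B x) x"
        by (subst sum.remove[OF _ True]) (use finite_gnd in auto)
      then show ?thesis using sign_square[of "fund_ci N B x" x] fund_ci[OF B, of x] True by (simp add: mult.assoc)
    next
      case False
      then have "x \<notin> gnd N" using x by auto
      moreover have "(\<Sum>y\<in>?T. ?c y * sg (fund_ci N B y) x) = 0"
        by (intro sum.neutral ballI) (use other False in auto)
      ultimately show ?thesis using z cycle_out by simp
    qed
  qed
  then show ?thesis by simp
qed

text \<open>Normalised to 1 at \<open>e\<close>; the value at x outside \<open>B\<close> is the one
  forced by orthogonality to the fundamental circuit of x.\<close>

definition fund_cocycle :: "'a set \<Rightarrow> 'a \<Rightarrow> 'a \<Rightarrow> int" where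
  "fund_cocycle B e x = (if x = e then 1
     else if x \<in> gnd N - B then - sg (fund_ci N B x) x * sg (fund_ci N B x) e else 0)"

lemma fund_cocycle_orthogonal:
  assumes B: "is_basis N B" and e: "e \<in> B" and z: "z \<in> Z"
  shows "(\<Sum>x\<in>gnd N. z x * fund_cocycle B e x) = 0"
proof -
  have Bg: "B \<subseteq> gnd N" using B by (auto simp: is_basis_def indep_def)
  have "(\<Sum>x\<in>gnd N. z x * fund_cocycle B e x)
      = (\<Sum>x\<in>gnd N - B. z x * fund_cocycle B e x) + (\<Sum>x\<in>B. z x * fund_cocycle B e x)"
    by (rule sum.subset_diff[OF Bg finite_gnd])
  also have "(\<Sum>x\<in>gnd N - B. z x * fund_cocycle B e x) = - z e"
    unfolding cycle_expand[OF B z, of e] sum_negf[symmetric]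
    using e by (intro sum.cong) (auto simp: fund_cocycle_def algebra_simps)
  also have "(\<Sum>x\<in>B. z x * fund_cocycle B e x) = z e * fund_cocycle B e e"
    by (subst sum.remove[OF _ e]) (use Bg finite_gnd finite_subset in \<open>auto simp: fund_cocycle_def\<close>)
  finally show ?thesis by (simp add: fund_cocycle_def)
qed

lemma fund_cocycle_values:
  assumes B: "is_basis N B" and e: "e \<in> B"
  shows "fund_cocycle B e x \<in> {1, -1} \<or> fund_cocycle B e x = 0"
    and "fund_cocycle B e x \<noteq> 0 \<longleftrightarrow> x = e \<or> x \<in> gnd N - B \<and> e \<in> fund_ci N B x"
proof -
  have "sg (fund_ci N B x) x \<in> {1, -1}" if "x \<in> gnd N - B"
    using fund_ci[OF B, of x] that by (intro sign_in) auto
  moreover have "sg (fund_ci N B x) e \<in> {1, -1} \<and> e \<in> fund_ci N B x \<or> sg (fund_ci N B x) e = 0 \<and> e \<notin> fund_ci N B x"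
    if "x \<in> gnd N - B"
    using fund_ci[OF B, of x] that sign_in[of "fund_ci N B x" e] sign_out[of "fund_ci N B x" e] by auto
  ultimately show "fund_cocycle B e x \<in> {1, -1} \<or> fund_cocycle B e x = 0"
    and "fund_cocycle B e x \<noteq> 0 \<longleftrightarrow> x = e \<or> x \<in> gnd N - B \<and> e \<in> fund_ci N B x"
    unfolding fund_cocycle_def by auto
qed

text \<open>If the support avoided \<open>B\<close>, pairing with the fundamental circuit of d would
  leave the single nonzero term at d.\<close>

lemma cocycle_meets_basis:
  assumes orth: "\<And>z. z \<in> Z \<Longrightarrow> (\<Sum>x\<in>gnd N. z x * \<tau> x) = 0"
    and d: "d \<in> gnd N" "\<tau> d \<noteq> 0" and B: "is_basis N B"
  shows "\<exists>x\<in>B. \<tau> x \<noteq> 0"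
proof (rule ccontr)
  assume no: "\<not> (\<exists>x\<in>B. \<tau> x \<noteq> 0)"
  with d have dB: "d \<notin> B" by auto
  note C = fund_ci[OF B d(1) dB]
  have "(\<Sum>x\<in>gnd N. sg (fund_ci N B d) x * \<tau> x) = sg (fund_ci N B d) d * \<tau> d"
    by (subst sum.remove[OF finite_gnd d(1)]) (use no C in \<open>auto intro!: sum.neutral sign_out\<close>)
  then show False using orth[OF sg_cycle[OF C(1)]] d(2) sign_nonzero_iff[OF C(1), of d] C(3) by simp
qed

text \<open>A maximal independent set \<open>B0\<close> in the complement of \<open>D\<close> is not
  a basis, so some basis \<open>B\<close> contains it together with a further element e. The support
  of the fundamental cocycle of e lies in \<open>D\<close> and meets every basis, so minimality of
  \<open>D\<close> makes it all of \<open>D\<close>.\<close>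

lemma cocircuit_signing:
  assumes D: "is_cocircuit N D"
  shows "\<exists>\<tau>. (\<forall>x. (x \<in> D \<longrightarrow> \<tau> x \<in> {1, -1}) \<and> (x \<notin> D \<longrightarrow> \<tau> x = (0::int))) \<and>
             (\<forall>z\<in>Z. (\<Sum>x\<in>gnd N. z x * \<tau> x) = 0)"
proof -
  obtain B0 where B0: "indep N B0" "B0 \<subseteq> gnd N - D"
    and max: "\<And>J. indep N J \<Longrightarrow> J \<subseteq> gnd N - D \<Longrightarrow> B0 \<subseteq> J \<Longrightarrow> J = B0"
    using maximal_indep[OF indep_empty, of "gnd N - D"] by auto
  have "\<not> is_basis N B0" using D B0 by (auto simp: is_cocircuit_def)
  then obtain I where I: "indep N I" "B0 \<subset> I" using B0 by (auto simp: is_basis_def)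
  then obtain e where e: "e \<in> I" "e \<notin> B0" by auto
  obtain B where B: "is_basis N B" "I \<subseteq> B" using basis_extend I by blast
  have eB: "e \<in> B" using e B by auto
  have BD: "x \<in> D" if "x \<in> B" "x \<notin> B0" for x
  proof (rule ccontr)
    assume "x \<notin> D"
    have "indep N (insert x B0)" by (rule indep_mono[of B]) (use B I that in \<open>auto simp: is_basis_def\<close>)
    then have "insert x B0 = B0" using max[of "insert x B0"] \<open>x \<notin> D\<close> B0 by (auto simp: indep_def)
    with that show False by auto
  qed
  let ?\<tau> = "fund_cocycle B e" and ?D = "{x. fund_cocycle B e x \<noteq> 0}"
  have orth: "z \<in> Z \<Longrightarrow> (\<Sum>x\<in>gnd N. z x * ?\<tau> x) = 0" for z
    by (rule fund_cocycle_orthogonal[OF B(1) eB])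
  have sub: "?D \<subseteq> D"
  proof
    fix y assume "y \<in> ?D"
    then consider "y = e" | "y \<in> gnd N - B" "e \<in> fund_ci N B y" using fund_cocycle_values(2)[OF B(1) eB] by auto
    then show "y \<in> D"
    proof cases
      case 1
      then show ?thesis using BD eB e by auto
    next
      case 2
      show ?thesis
      proof (rule ccontr)
        assume "y \<notin> D"
        \<comment> \<open>By maximality of \<open>B0\<close> the fundamental circuit of y already
          lies in \<open>insert y B0\<close>, so it cannot contain e.\<close>
        have "\<not> indep N (insert y B0)"
        proof
          assume "indep N (insert y B0)"
          then have "insert y B0 = B0" using max[of "insert y B0"] \<open>y \<notin> D\<close> B0 2 by auto
          then show False using 2 I B by auto
        qed
        then obtain C where C: "C \<in> circuits N" "C \<subseteq> insert y B0" using B0 2 by (auto simp: indep_def)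
        then have "fund_ci N B y = C" using B I by (intro fund_ci_eq) (auto simp: is_basis_def)
        then show False using 2 C e eB by auto
      qed
    qed
  qed
  have eD: "?\<tau> e \<noteq> 0" "e \<in> gnd N" using B eB by (auto simp: fund_cocycle_def is_basis_def indep_def)
  have "?D = D"
  proof (rule ccontr)
    assume "?D \<noteq> D"
    then have "?D \<subset> D" using sub by auto
    then obtain B' where "is_basis N B'" "?D \<inter> B' = {}" using D eD unfolding is_cocircuit_def by blast
    then show False using cocycle_meets_basis[OF orth eD(2,1)] by blast
  qed
  then show ?thesis using fund_cocycle_values(1)[OF B(1) eB] orth by (intro exI[of _ ?\<tau>]) blast
qed

lemma cocircuit_subset_of_transversal:
  assumes "D \<subseteq> gnd N" "\<And>B. is_basis N B \<Longrightarrow> D \<inter> B \<noteq> {}"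
  shows "\<exists>D'. is_cocircuit N D' \<and> D' \<subseteq> D"
proof -
  let ?F = "{X. X \<subseteq> D \<and> (\<forall>B. is_basis N B \<longrightarrow> X \<inter> B \<noteq> {})}"
  have "finite ?F" using assms(1) finite_gnd by (auto intro: finite_subset[of _ "Pow (gnd N)"])
  moreover have "D \<in> ?F" using assms by auto
  ultimately obtain X where X: "X \<in> ?F" "\<forall>Y\<in>?F. Y \<subseteq> X \<longrightarrow> X = Y"
    using finite_has_minimal[of ?F] by blast
  obtain B where "is_basis N B" using basis_extend indep_empty by blast
  then have "X \<noteq> {}" using X by auto
  moreover have "\<exists>B. is_basis N B \<and> Y \<inter> B = {}" if "Y \<subset> X" for Y
  proof (rule ccontr)
    assume "\<not> ?thesis"
    then have "Y \<in> ?F" using that X(1) by auto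
    then show False using X(2) that by blast
  qed
  ultimately have "is_cocircuit N X" using X(1) assms(1) unfolding is_cocircuit_def by simp (meson subset_trans)
  then show ?thesis using X(1) by auto
qed

text \<open>A cocircuit inside \<open>insert b (gnd N - B)\<close> meets the fundamental circuit of
  y at most in b and y, and orthogonality makes it contain both or neither. This determines the
  cocircuit. One exists because the support of the fundamental cocycle meets all bases and hence
  contains a cocircuit, which meets \<open>B\<close> in b.\<close>

lemma fund_coc_eq:
  assumes B: "is_basis N B" and b: "b \<in> B"
  shows "fund_coc N B b = insert b {y \<in> gnd N - B. b \<in> fund_ci N B y}" (is "_ = ?D")
    and "is_cocircuit N (fund_coc N B b)"
proof -
  have Bg: "B \<subseteq> gnd N" using B by (auto simp: is_basis_def indep_def)
  have unique: "D = ?D" if D: "is_cocircuit N D" "D \<subseteq> insert b (gnd N - B)" "b \<in> D" for D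
  proof -
    obtain \<tau> where \<tau>: "\<And>x. x \<in> D \<Longrightarrow> \<tau> x \<in> {1, -1::int}" "\<And>x. x \<notin> D \<Longrightarrow> \<tau> x = 0"
      and orth: "\<And>z. z \<in> Z \<Longrightarrow> (\<Sum>x\<in>gnd N. z x * \<tau> x) = 0"
      using cocircuit_signing[OF D(1)] by blast
    have "y \<in> D \<longleftrightarrow> b \<in> fund_ci N B y" if y: "y \<in> gnd N - B" for y
    proof -
      note C = fund_ci[OF B, of y]
      let ?C = "fund_ci N B y"
      have "(\<Sum>x\<in>gnd N. sg ?C x * \<tau> x) = (\<Sum>x\<in>{b, y}. sg ?C x * \<tau> x)"
        using D(2) y C Bg b finite_gnd
        by (intro sum.mono_neutral_right) (auto intro!: sign_out \<tau>(2))
      also have "\<dots> = sg ?C b * \<tau> b + sg ?C y * \<tau> y" using b y by (subst sum.insert) auto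
      finally have "sg ?C b * \<tau> b + sg ?C y * \<tau> y = 0" using orth[OF sg_cycle] C y by auto
      moreover have "\<tau> b \<in> {1, -1}" "sg ?C y \<in> {1, -1}" using \<tau>(1) D(3) sign_in[of ?C y] C y by auto
      ultimately have "sg ?C b \<noteq> 0 \<longleftrightarrow> \<tau> y \<noteq> 0" by auto
      moreover have "\<tau> y \<noteq> 0 \<longleftrightarrow> y \<in> D" using \<tau>[of y] by auto
      ultimately show ?thesis using sign_nonzero_iff[of ?C b] C y by auto
    qed
    then show ?thesis using D by auto
  qed
  have supp: "?D = {x. fund_cocycle B b x \<noteq> 0}" using fund_cocycle_values(2)[OF B b] by auto
  have "?D \<inter> B' \<noteq> {}" if "is_basis N B'" for B'
  proof -
    have "b \<in> gnd N" "fund_cocycle B b b \<noteq> 0" using b Bg by (auto simp: fund_cocycle_def)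
    then show ?thesis
      using cocycle_meets_basis[OF fund_cocycle_orthogonal[OF B b] _ _ that] unfolding supp by blast
  qed
  then obtain D where D: "is_cocircuit N D" "D \<subseteq> ?D"
    using cocircuit_subset_of_transversal[of ?D] b Bg by blast
  have "D \<inter> B \<noteq> {}" using D B by (auto simp: is_cocircuit_def)
  then have "b \<in> D" using D(2) by auto
  then have coc: "is_cocircuit N ?D" using unique[of D] D by auto
  show eq: "fund_coc N B b = ?D"
    unfolding fund_coc_def by (rule the_equality) (use coc unique in auto)
  show "is_cocircuit N (fund_coc N B b)" using coc unfolding eq .
qed

text \<open>Integer orthogonality passes to every field. The second conjunct keeps orthogonality to
  all of \<open>Z\<close>, from which relations for cycles with polynomial coefficients are derived
  later.\<close>

lemma admissible_signing_exists:
  "\<exists>\<tau>. admissible_signing TYPE('k::field) N sg \<tau> \<and>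
     (\<forall>D\<in>cocircuits N. (\<forall>x. (x \<in> D \<longrightarrow> \<tau> D x \<in> {1, -1}) \<and> (x \<notin> D \<longrightarrow> \<tau> D x = 0)) \<and>
        (\<forall>z\<in>Z. (\<Sum>x\<in>gnd N. z x * \<tau> D x) = 0))"
proof -
  have "\<forall>D\<in>cocircuits N. \<exists>\<tau>. (\<forall>x. (x \<in> D \<longrightarrow> \<tau> x \<in> {1, -1}) \<and> (x \<notin> D \<longrightarrow> \<tau> x = (0::int))) \<and>
             (\<forall>z\<in>Z. (\<Sum>x\<in>gnd N. z x * \<tau> x) = 0)"
    using cocircuit_signing by (auto simp: cocircuits_def)
  then obtain \<tau> where \<tau>: "\<forall>D\<in>cocircuits N. (\<forall>x. (x \<in> D \<longrightarrow> \<tau> D x \<in> {1, -1}) \<and> (x \<notin> D \<longrightarrow> \<tau> D x = (0::int))) \<and>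
             (\<forall>z\<in>Z. (\<Sum>x\<in>gnd N. z x * \<tau> D x) = 0)" by (rule bchoice[THEN exE])
  have "(\<Sum>x\<in>gnd N. (of_int (sg C x * \<tau> D x) :: 'k)) = 0" if "C \<in> circuits N" "D \<in> cocircuits N" for C D
    using \<tau> that sg_cycle by (simp flip: of_int_sum del: of_int_mult)
  then have "admissible_signing TYPE('k) N sg \<tau>"
    unfolding admissible_signing_def using \<tau> sign_in sign_out by (intro conjI ballI allI impI) simp_all
  with \<tau> show ?thesis by (intro exI[of _ \<tau>] conjI)
qed

end

subsection \<open>Chains of cycles\<close>

locale cycle_chain =
  fixes t :: nat and n :: "nat \<Rightarrow> nat" and E :: "nat \<Rightarrow> 'a set" and p :: "nat \<Rightarrow> 'a"
  assumes t_pos: "t \<ge> 1"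
    and cycle_size: "i \<in> {1..t} \<Longrightarrow> finite (E i) \<and> card (E i) = n i \<and> n i \<ge> 2"
    and consecutive: "1 \<le> i \<Longrightarrow> i \<le> t - 1 \<Longrightarrow> E i \<inter> E (i + 1) = {p (i + 1)}"
    and apart: "i \<in> {1..t} \<Longrightarrow> j \<in> {1..t} \<Longrightarrow> i + 2 \<le> j \<Longrightarrow> E i \<inter> E j = {}"
    and p_distinct: "i \<in> {2..t} \<Longrightarrow> j \<in> {2..t} \<Longrightarrow> i \<noteq> j \<Longrightarrow> p i \<noteq> p j"
begin

abbreviation "M \<equiv> \<lambda>i. uniform_matroid (n i - 1) (E i)"
definition N :: "'a matroid" where "N = par_iter M p (t - 1)"

definition join_cycles :: "nat \<Rightarrow> nat \<Rightarrow> 'a set" where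
  "join_cycles a b = \<Union> (E ` {a..b}) - p ` {a<..b}"

section \<open>Circuits of the iterated parallel connection\<close>

lemma p_mem:
  assumes "k \<in> {2..t}"
  shows "p k \<in> E (k - 1)" and "p k \<in> E k"
proof -
  have "E (k - 1) \<inter> E k = {p k}" using consecutive[of "k - 1"] assms by fastforce
  then show "p k \<in> E (k - 1)" "p k \<in> E k" by auto
qed

lemma p_mem_iff:
  assumes "k \<in> {2..t}" "l \<in> {1..t}"
  shows "p k \<in> E l \<longleftrightarrow> l = k - 1 \<or> l = k"
proof
  assume l: "p k \<in> E l"
  show "l = k - 1 \<or> l = k"
  proof (rule ccontr)
    assume "\<not> ?thesis"
    then have "l + 2 \<le> k \<or> (k - 1) + 2 \<le> l" using assms by auto
    moreover have "k - 1 \<in> {1..t}" "k \<in> {1..t}" using assms by auto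
    ultimately show False using apart[of l k] apart[of "k - 1" l] p_mem[OF assms(1)] l assms(2) by blast
  qed
qed (use p_mem[OF assms(1)] in auto)

lemma circuits_cycle:
  assumes "i \<in> {1..t}"
  shows "circuits (M i) = {E i}"
proof -
  have "finite (E i)" "n i - 1 + 1 = card (E i)" using cycle_size[OF assms] by auto
  then have "C \<subseteq> E i \<and> card C = n i - 1 + 1 \<longleftrightarrow> C = E i" for C using card_subset_eq[of "E i" C] by auto
  then show ?thesis unfolding circuits_def uniform_matroid_def by simp
qed

text \<open>Shared elements in the interior of the interval are removed, so one survives only at
  either end.\<close>

lemma p_mem_join:
  assumes "k \<in> {2..t}" "1 \<le> a" "a \<le> b" "b \<le> t"
  shows "p k \<in> join_cycles a b \<longleftrightarrow> k = a \<or> k = b + 1"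
proof -
  have "p k \<in> \<Union> (E ` {a..b}) \<longleftrightarrow> k - 1 \<in> {a..b} \<or> k \<in> {a..b}"
    using p_mem_iff[OF assms(1)] assms by fastforce
  moreover have "p k \<in> p ` {a<..b} \<longleftrightarrow> k \<in> {a<..b}"
  proof
    assume "p k \<in> p ` {a<..b}"
    then obtain l where "l \<in> {a<..b}" "p k = p l" by blast
    then show "k \<in> {a<..b}" using p_distinct[OF assms(1), of l] assms by (cases "k = l") auto
  qed auto
  ultimately show ?thesis using assms unfolding join_cycles_def by auto
qed

lemma join_Suc:
  assumes "1 \<le> a" "a \<le> b" "b < t"
  shows "join_cycles a b \<union> E (Suc b) - {p (Suc b)} = join_cycles a (Suc b)"
proof -
  have "p l \<notin> E (Suc b)" if "l \<in> {a<..b}" for l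
    using p_mem_iff[of l "Suc b"] that assms by auto
  then have "p ` {a<..b} \<inter> E (Suc b) = {}" by auto
  moreover have "{a..Suc b} = insert (Suc b) {a..b}" "{a<..Suc b} = insert (Suc b) {a<..b}" using assms by auto
  ultimately show ?thesis unfolding join_cycles_def by auto
qed

text \<open>Only joins ending in the last cycle contain the next gluing element, so the new circuits
  are exactly the joins ending in the new cycle. The stage \<open>par_iter M p j\<close> has j + 1
  cycles, so the cycle glued next has index j + 2.\<close>

lemma par_iter_chain:
  assumes "j < t"
  shows "gnd (par_iter M p j) = \<Union> (E ` {1..Suc j}) \<and>
    circuits (par_iter M p j) = {join_cycles a b | a b. 1 \<le> a \<and> a \<le> b \<and> b \<le> Suc j}"
  using assms
proof (induction j)
  case 0
  have "{join_cycles a b | a b. 1 \<le> a \<and> a \<le> b \<and> b \<le> Suc 0} = {join_cycles 1 1}"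
  proof -
    have "1 \<le> a \<and> a \<le> b \<and> b \<le> Suc 0 \<longleftrightarrow> a = 1 \<and> b = 1" for a b :: nat by auto
    then show ?thesis by auto
  qed
  moreover have "join_cycles 1 1 = E 1" by (simp add: join_cycles_def)
  ultimately show ?case using circuits_cycle[of 1] t_pos by (auto simp: gnd_def uniform_matroid_def)
next
  case (Suc j)
  let ?P = "par_iter M p j" and ?k = "Suc (Suc j)"
  have IH: "gnd ?P = \<Union> (E ` {1..Suc j})"
     "circuits ?P = {join_cycles a b | a b. 1 \<le> a \<and> a \<le> b \<and> b \<le> Suc j}" using Suc by auto
  have cM: "circuits (M ?k) = {E ?k}" using circuits_cycle[of ?k] Suc.prems by auto
  have pk: "p ?k \<in> E ?k" using p_mem(2)[of ?k] Suc.prems by auto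
  have "gnd (par_iter M p (Suc j)) = gnd ?P \<union> E ?k"
    by (simp add: par_conn_def gnd_def uniform_matroid_def)
  also have "\<dots> = \<Union> (E ` {1..?k})" unfolding IH by (auto simp: atLeastAtMostSuc_conv)
  finally have g: "gnd (par_iter M p (Suc j)) = \<Union> (E ` {1..?k})" .
  have new: "{(C1 \<union> C2) - {p ?k} | C1 C2. C1 \<in> circuits ?P \<and> C2 \<in> circuits (M ?k) \<and> p ?k \<in> C1 \<and> p ?k \<in> C2}
      = {join_cycles a ?k | a. 1 \<le> a \<and> a \<le> Suc j}" (is "?L = ?R")
  proof (intro equalityI subsetI)
    fix X assume "X \<in> ?L"
    then obtain a b where ab: "1 \<le> a" "a \<le> b" "b \<le> Suc j" "p ?k \<in> join_cycles a b"
      "X = join_cycles a b \<union> E ?k - {p ?k}" unfolding IH cM by auto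
    then have "b = Suc j" using p_mem_join[of ?k a b] Suc.prems by auto
    then have "X = join_cycles a ?k" using ab join_Suc[of a "Suc j"] Suc.prems by auto
    then show "X \<in> ?R" using ab \<open>b = Suc j\<close> by auto
  next
    fix X assume "X \<in> ?R"
    then obtain a where a: "1 \<le> a" "a \<le> Suc j" "X = join_cycles a ?k" by auto
    then have "X = join_cycles a (Suc j) \<union> E ?k - {p ?k}" using join_Suc[of a "Suc j"] Suc.prems by auto
    moreover have "p ?k \<in> join_cycles a (Suc j)" using p_mem_join[of ?k a "Suc j"] Suc.prems a by auto
    ultimately show "X \<in> ?L" unfolding IH cM using a pk by blast
  qed
  have "circuits (par_iter M p (Suc j)) = circuits ?P \<union> {E ?k} \<union> {join_cycles a ?k | a. 1 \<le> a \<and> a \<le> Suc j}"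
    using new cM by (simp add: par_conn_def circuits_def)
  also have "E ?k = join_cycles ?k ?k" by (simp add: join_cycles_def)
  also have "circuits ?P \<union> {join_cycles ?k ?k} \<union> {join_cycles a ?k | a. 1 \<le> a \<and> a \<le> Suc j}
      = {join_cycles a b | a b. 1 \<le> a \<and> a \<le> b \<and> b \<le> ?k}" (is "?L = ?R")
  proof (intro equalityI subsetI)
    fix X assume "X \<in> ?R"
    then obtain a b where ab: "1 \<le> a" "a \<le> b" "b \<le> ?k" "X = join_cycles a b" by auto
    then consider "b \<le> Suc j" | "b = ?k" "a = ?k" | "b = ?k" "a \<le> Suc j" by linarith
    then show "X \<in> ?L" using ab IH(2) by cases blast+
  next
    fix X assume "X \<in> ?L"
    then consider "X \<in> circuits ?P" | "X = join_cycles ?k ?k" | "X \<in> {join_cycles a ?k | a. 1 \<le> a \<and> a \<le> Suc j}" by auto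
    then show "X \<in> ?R"
    proof cases
      case 1
      then obtain a b where "1 \<le> a" "a \<le> b" "b \<le> Suc j" "X = join_cycles a b" unfolding IH by auto
      then show ?thesis by (intro CollectI exI[of _ a] exI[of _ b]) auto
    next
      case 2
      then show ?thesis by (intro CollectI exI[of _ ?k]) auto
    next
      case 3
      then obtain a where "1 \<le> a" "a \<le> Suc j" "X = join_cycles a ?k" by auto
      then show ?thesis by (intro CollectI exI[of _ a] exI[of _ ?k]) auto
    qed
  qed
  finally show ?case using g by simp
qed

lemma gnd_N: "gnd N = \<Union> (E ` {1..t})"
  and circuits_N: "circuits N = {join_cycles a b | a b. 1 \<le> a \<and> a \<le> b \<and> b \<le> t}"
  using par_iter_chain[of "t - 1"] t_pos by (auto simp: N_def)

lemma circuit_cases: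
  assumes "C \<in> circuits N"
  obtains a b where "1 \<le> a" "a \<le> b" "b \<le> t" "C = join_cycles a b"
  using assms unfolding circuits_N by auto

lemma join_subset_gnd: "1 \<le> a \<Longrightarrow> b \<le> t \<Longrightarrow> join_cycles a b \<subseteq> gnd N"
  unfolding gnd_N join_cycles_def by auto

section \<open>Private and shared elements of the cycles\<close>

definition R :: "nat \<Rightarrow> 'a set" where "R i = E i - p ` {2..t}"

lemma R_disjoint: "i \<in> {1..t} \<Longrightarrow> j \<in> {1..t} \<Longrightarrow> i \<noteq> j \<Longrightarrow> R i \<inter> R j = {}"
proof (induction i j rule: linorder_wlog)
  case (le i j)
  show ?case
  proof (cases "j = i + 1")
    case True
    then have "E i \<inter> E j = {p j}" "j \<in> {2..t}" using consecutive[of i] le by auto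
    then show ?thesis unfolding R_def by auto
  next
    case False
    then show ?thesis using apart[of i j] le unfolding R_def by auto
  qed
qed (auto simp: Int_commute)

lemma R_p: "k \<in> {2..t} \<Longrightarrow> p k \<notin> R i"
  by (auto simp: R_def)

lemma R_same: "x \<in> R i \<Longrightarrow> x \<in> R j \<Longrightarrow> i \<in> {1..t} \<Longrightarrow> j \<in> {1..t} \<Longrightarrow> i = j"
  using R_disjoint by blast

lemma p_same: "p k = p l \<Longrightarrow> k \<in> {2..t} \<Longrightarrow> l \<in> {2..t} \<Longrightarrow> k = l"
  using p_distinct by blast

lemma finite_R: "i \<in> {1..t} \<Longrightarrow> finite (R i)"
  using cycle_size by (auto simp: R_def)

lemma E_eq: "i \<in> {1..t} \<Longrightarrow> E i = R i \<union> (if 2 \<le> i then {p i} else {}) \<union> (if i < t then {p (i + 1)} else {})"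
proof -
  assume i: "i \<in> {1..t}"
  have "E i \<inter> p ` {2..t} = (if 2 \<le> i then {p i} else {}) \<union> (if i < t then {p (i + 1)} else {})"
    using p_mem_iff[OF _ i] i by (auto split: if_splits simp: image_iff) 
  then show ?thesis unfolding R_def by blast
qed

lemma n_eq: "i \<in> {1..t} \<Longrightarrow> n i = card (R i) + (if 2 \<le> i then 1 else 0) + (if i < t then 1 else 0)"
proof -
  assume i: "i \<in> {1..t}"
  have "p i \<notin> R i" if "2 \<le> i" using R_p i that by auto
  moreover have "p (i + 1) \<notin> R i" if "i < t" using R_p i that by auto
  moreover have "p i \<noteq> p (i + 1)" if "2 \<le> i" "i < t" using p_same[of i "i + 1"] that by auto
  ultimately have "card (E i) = card (R i) + (if 2 \<le> i then 1 else 0) + (if i < t then 1 else 0)"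
    using finite_R[OF i] by (subst E_eq[OF i]) (auto simp: card_insert_if)
  then show ?thesis using cycle_size[OF i] by simp
qed

text \<open>A cycle has at least two elements, while an end cycle shares at most one; only an
  interior cycle of size two can lack private elements.\<close>

lemma R_empty: "i \<in> {1..t} \<Longrightarrow> R i = {} \<Longrightarrow> 2 \<le> i \<and> i < t"
  using n_eq[of i] cycle_size[of i] by (auto split: if_splits)

lemma join_eq:
  assumes "1 \<le> a" "a \<le> b" "b \<le> t"
  shows "join_cycles a b = \<Union> (R ` {a..b}) \<union> (if 2 \<le> a then {p a} else {}) \<union> (if b < t then {p (b + 1)} else {})"
proof (intro set_eqI)
  fix x
  show "x \<in> join_cycles a b \<longleftrightarrow> x \<in> \<Union> (R ` {a..b}) \<union> (if 2 \<le> a then {p a} else {}) \<union> (if b < t then {p (b + 1)} else {})"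
  proof (cases "x \<in> p ` {2..t}")
    case True
    then obtain k where k: "x = p k" "k \<in> {2..t}" by auto
    have "x \<in> join_cycles a b \<longleftrightarrow> k = a \<or> k = b + 1" using p_mem_join[OF k(2) assms] k by simp
    moreover have "x \<notin> \<Union> (R ` {a..b})" using True by (auto simp: R_def)
    moreover have "2 \<le> a \<Longrightarrow> x = p a \<longleftrightarrow> k = a" "b < t \<Longrightarrow> x = p (b + 1) \<longleftrightarrow> k = b + 1"
      using p_same[OF _ k(2)] k(1) assms by auto
    ultimately show ?thesis using k(2) by auto
  next
    case False
    then have "x \<in> join_cycles a b \<longleftrightarrow> x \<in> \<Union> (R ` {a..b})"
      using assms unfolding join_cycles_def R_def by auto
    moreover have "2 \<le> a \<Longrightarrow> x \<noteq> p a" "b < t \<Longrightarrow> x \<noteq> p (b + 1)" using False assms by auto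
    ultimately show ?thesis by auto
  qed
qed

lemma gnd_cases:
  assumes "x \<in> gnd N"
  obtains (R) i where "i \<in> {1..t}" "x \<in> R i" | (p) k where "k \<in> {2..t}" "x = p k"
proof (cases "x \<in> p ` {2..t}")
  case False
  from assms obtain i where "i \<in> {1..t}" "x \<in> E i" unfolding gnd_N by auto
  with False show ?thesis using that(1) by (auto simp: R_def)
qed (use that(2) in auto)

lemma R_gnd: "i \<in> {1..t} \<Longrightarrow> x \<in> R i \<Longrightarrow> x \<in> gnd N"
  unfolding gnd_N R_def by auto

lemma p_gnd: "k \<in> {2..t} \<Longrightarrow> p k \<in> gnd N"
  unfolding gnd_N using p_mem(2)[of k] by auto

lemma finite_gnd_N: "finite (gnd N)"
  unfolding gnd_N using cycle_size by auto

text \<open>The coordinate \<open>x\<close> of the signed cycle \<open>\<Sum>\<^sub>i c\<^sub>i E\<^sub>i\<close>, where \<open>p\<^sub>k\<close> has sign \<open>+\<close> in \<open>E\<^sub>k\<close> and \<open>-\<close> in \<open>E\<^sub>k\<^sub>-\<^sub>1\<close>.\<close>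

definition inc :: "nat \<Rightarrow> 'a \<Rightarrow> int" where
  "inc i x = (if x \<in> R i then 1 else if 2 \<le> i \<and> x = p i then 1 else if i < t \<and> x = p (i + 1) then - 1 else 0)"

text \<open>The coefficient ring is arbitrary: integers give the cycle lattice, polynomials give the
  linear forms substituted for the variables.\<close>

definition lin :: "(nat \<Rightarrow> 'r::comm_ring_1) \<Rightarrow> 'a \<Rightarrow> 'r" where
  "lin c x = (\<Sum>i\<in>{1..t}. of_int (inc i x) * c i)"

lemma lin_R:
  assumes "i \<in> {1..t}" "x \<in> R i"
  shows "lin c x = c i"
proof -
  have "inc l x = (if l = i then 1 else 0)" if "l \<in> {1..t}" for l
  proof (cases "l = i")
    case False
    then have "x \<notin> R l" using R_same[of x l i] assms that by blast
    moreover have "x \<noteq> p l" if "2 \<le> l" using R_p[of l i] assms(2) that \<open>l \<in> {1..t}\<close> by auto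
    moreover have "x \<noteq> p (l + 1)" if "l < t" using R_p[of "l + 1" i] assms(2) that \<open>l \<in> {1..t}\<close> by auto
    ultimately show ?thesis using False unfolding inc_def by auto
  qed (use assms in \<open>simp add: inc_def\<close>)
  then have "lin c x = (\<Sum>l\<in>{1..t}. if l = i then c l else 0)"
    unfolding lin_def by (intro sum.cong) auto
  then show ?thesis using assms by simp
qed

lemma lin_p:
  assumes k: "k \<in> {2..t}"
  shows "lin c (p k) = c k - c (k - 1)"
proof -
  have "inc l (p k) = (if l = k then 1 else 0) - (if l = k - 1 then 1 else 0)" if l: "l \<in> {1..t}" for l
  proof -
    have "2 \<le> l \<Longrightarrow> p k = p l \<longleftrightarrow> l = k" "l < t \<Longrightarrow> p k = p (l + 1) \<longleftrightarrow> l = k - 1"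
      using p_same[of k l] p_same[of k "l + 1"] l k by auto
    then show ?thesis using R_p[OF k, of l] k l unfolding inc_def by auto
  qed
  then have "lin c (p k) = (\<Sum>l\<in>{1..t}. (if l = k then c l else 0) - (if l = k - 1 then c l else 0))"
    unfolding lin_def by (intro sum.cong) auto
  then show ?thesis using k by (auto simp: sum_subtractf)
qed

lemma inc_out: "x \<notin> gnd N \<Longrightarrow> i \<in> {1..t} \<Longrightarrow> inc i x = 0"
  using R_gnd[of i x] p_gnd[of i] p_gnd[of "i + 1"] unfolding inc_def by auto

lemma lin_out: "x \<notin> gnd N \<Longrightarrow> lin c x = 0"
  unfolding lin_def by (simp add: inc_out)

lemma lin_diff: "lin c x - a * lin c' x = lin (\<lambda>i. c i - a * c' i) x"
  unfolding lin_def by (simp add: sum_distrib_left sum_subtractf[symmetric] algebra_simps)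

text \<open>At \<open>p k\<close> the value is the difference of neighbouring indicator values,
  which is nonzero only at the two ends of the interval.\<close>

lemma lin_indicator:
  assumes "1 \<le> a" "a \<le> b" "b \<le> t"
  shows "x \<in> join_cycles a b \<Longrightarrow> lin (\<lambda>i. if i \<in> {a..b} then 1 else 0::int) x \<in> {1, -1}"
    and "x \<notin> join_cycles a b \<Longrightarrow> lin (\<lambda>i. if i \<in> {a..b} then 1 else 0::int) x = 0"
proof -
  let ?c = "\<lambda>i. if i \<in> {a..b} then 1 else 0::int"
  have "(x \<in> join_cycles a b \<longrightarrow> lin ?c x \<in> {1, -1}) \<and> (x \<notin> join_cycles a b \<longrightarrow> lin ?c x = 0)"
  proof (cases "x \<in> gnd N")
    case True
    then show ?thesis
    proof (cases x rule: gnd_cases)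
      case (R i)
      have "x \<in> join_cycles a b \<longleftrightarrow> i \<in> {a..b}"
      proof
        assume "x \<in> join_cycles a b"
        then have "x \<in> \<Union> (R ` {a..b})" using R(2) R_p[of a i] R_p[of "b + 1" i] assms
          unfolding join_eq[OF assms] by (auto split: if_splits)
        then obtain l where "l \<in> {a..b}" "x \<in> R l" by auto
        then show "i \<in> {a..b}" using R_same[of x i l] R assms by auto
      qed (use R in \<open>auto simp: join_eq[OF assms]\<close>)
      then show ?thesis by (simp add: lin_R[OF R])
    next
      case (p k)
      then show ?thesis using p_mem_join[OF p(1) assms] lin_p[OF p(1), of ?c] assms by auto
    qed
  next
    case False
    then have "x \<notin> join_cycles a b" using assms unfolding join_cycles_def gnd_N by auto
    then show ?thesis by (simp add: lin_out[OF False])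
  qed
  then show "x \<in> join_cycles a b \<Longrightarrow> lin ?c x \<in> {1, -1}" "x \<notin> join_cycles a b \<Longrightarrow> lin ?c x = 0" by auto
qed

text \<open>Choosing a representing interval fixes the sign vector without appeal to injectivity of
  \<open>join_cycles\<close>.\<close>

definition csign :: "'a set \<Rightarrow> 'a \<Rightarrow> int" where
  "csign C = (SOME z. \<exists>a b. 1 \<le> a \<and> a \<le> b \<and> b \<le> t \<and> C = join_cycles a b \<and>
     z = lin (\<lambda>i. if i \<in> {a..b} then 1 else 0))"

lemma csign:
  assumes "C \<in> circuits N"
  obtains a b where "1 \<le> a" "a \<le> b" "b \<le> t" "C = join_cycles a b" "csign C = lin (\<lambda>i. if i \<in> {a..b} then 1 else 0)"
proof -
  have "\<exists>z a b. 1 \<le> a \<and> a \<le> b \<and> b \<le> t \<and> C = join_cycles a b \<and>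
     z = lin (\<lambda>i. if i \<in> {a..b} then 1 else 0 :: int)" using assms unfolding circuits_N by blast
  from someI_ex[OF this] show ?thesis using that unfolding csign_def by blast
qed

text \<open>Take a maximal interval on which c has a constant nonzero value. Private elements carry
  this value, and at an end p the difference is nonzero by maximality.\<close>

lemma lin_support:
  fixes c :: "nat \<Rightarrow> int"
  assumes "lin c x \<noteq> 0"
  shows "\<exists>a b. 1 \<le> a \<and> a \<le> b \<and> b \<le> t \<and> (\<forall>y\<in>join_cycles a b. lin c y \<noteq> 0)"
proof -
  have "\<exists>i\<in>{1..t}. c i \<noteq> 0"
  proof (rule ccontr)
    assume "\<not> ?thesis"
    then have "lin c x = 0" unfolding lin_def by (intro sum.neutral) auto
    with assms show False by simp
  qed
  then obtain i where i: "i \<in> {1..t}" "c i \<noteq> 0" by blast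
  let ?A = "\<lambda>a. 1 \<le> a \<and> a \<le> i \<and> (\<forall>l\<in>{a..i}. c l = c i)"
  let ?B = "\<lambda>b. i \<le> b \<and> b \<le> t \<and> (\<forall>l\<in>{i..b}. c l = c i)"
  define a where "a = (LEAST a. ?A a)"
  define b where "b = (GREATEST b. ?B b)"
  have a: "?A a" unfolding a_def by (rule LeastI[of ?A i]) (use i in auto)
  have b: "?B b" unfolding b_def
  proof (rule GreatestI_nat)
    show "?B i" using i by auto
    show "\<And>b. ?B b \<Longrightarrow> b \<le> t" by blast
  qed
  have ab: "1 \<le> a" "a \<le> b" "b \<le> t" using a b by linarith+
  have left: "c (a - 1) \<noteq> c i" if "2 \<le> a"
  proof
    assume "c (a - 1) = c i"
    then have "\<forall>l\<in>insert (a - 1) {a..i}. c l = c i" using a by blast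
    moreover have "1 \<le> a \<and> a \<le> i" using a by blast
    then have "{a - 1..i} = insert (a - 1) {a..i}" "1 \<le> a - 1" "a - 1 \<le> i" using that by auto
    ultimately have "?A (a - 1)" by (simp only: simp_thms)
    then have "(LEAST a. ?A a) \<le> a - 1" by (rule Least_le)
    then show False using that unfolding a_def[symmetric] by linarith
  qed
  have right: "c (b + 1) \<noteq> c i" if "b < t"
  proof
    assume "c (b + 1) = c i"
    then have "\<forall>l\<in>insert (b + 1) {i..b}. c l = c i" using b by blast
    moreover have "i \<le> b \<and> b \<le> t" using b by blast
    then have "{i..b + 1} = insert (b + 1) {i..b}" "i \<le> b + 1" "b + 1 \<le> t" using that by auto
    ultimately have "?B (b + 1)" by (simp only: simp_thms)
    then have "b + 1 \<le> (GREATEST b. ?B b)" by (rule Greatest_le_nat[of ?B _ t]) blast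
    then show False unfolding b_def[symmetric] by linarith
  qed
  have const: "c l = c i" if "l \<in> {a..b}" for l 
  proof (cases "l \<le> i")
    case True
    then have "l \<in> {a..i}" using that by auto
    then show ?thesis using a by blast
  next
    case False
    then have "l \<in> {i..b}" using that by auto
    then show ?thesis using b by blast
  qed
  have "lin c y \<noteq> 0" if y: "y \<in> join_cycles a b" for y
  proof -
    from y consider l where "l \<in> {a..b}" "y \<in> R l" | "2 \<le> a" "y = p a" | "b < t" "y = p (b + 1)"
      unfolding join_eq[OF ab] by (auto split: if_splits)
    then show ?thesis
    proof cases
      case 1
      then have "lin c y = c l" using ab by (intro lin_R) auto
      with const[OF 1(1)] i(2) show ?thesis by simp
    next
      case 2
      then have "lin c y = c a - c (a - 1)" using lin_p[of a c] ab by auto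
      with const[of a] left[OF 2(1)] ab show ?thesis by simp
    next
      case 3
      then have "lin c y = c (b + 1) - c b" using lin_p[of "b + 1" c] ab by auto
      with const[of b] right[OF 3(1)] ab show ?thesis by simp
    qed
  qed
  then show ?thesis using ab by blast
qed

section \<open>Representatives, the basis and its fundamental circuits\<close>

definition pick :: "nat \<Rightarrow> 'a" where
  "pick i = (if R i = {} then p i else (SOME x. x \<in> R i))"

lemma pick_R: "R i \<noteq> {} \<Longrightarrow> pick i \<in> R i"
  unfolding pick_def by (simp add: some_in_eq)

lemma pick_p: "R i = {} \<Longrightarrow> pick i = p i"
  by (simp add: pick_def)

lemma pick_gnd: "i \<in> {1..t} \<Longrightarrow> pick i \<in> gnd N"
  using pick_R[of i] pick_p[of i] R_gnd[of i] p_gnd[of i] R_empty[of i] by (cases "R i = {}") auto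

lemma pick_mem_R: "i \<in> {1..t} \<Longrightarrow> l \<in> {1..t} \<Longrightarrow> pick i \<in> R l \<Longrightarrow> i = l"
  using pick_R[of i] pick_p[of i] R_same[of "pick i" i l] R_p[of i l] R_empty[of i] by (cases "R i = {}") auto

lemma pick_eq_p: "i \<in> {1..t} \<Longrightarrow> k \<in> {2..t} \<Longrightarrow> pick i = p k \<longleftrightarrow> i = k \<and> R i = {}"
  using pick_R[of i] pick_p[of i] p_same[of i k] R_p[of k i] R_empty[of i] by (cases "R i = {}") auto

lemma inj_pick: "inj_on pick {1..t}"
proof (rule inj_onI)
  fix i j assume ij: "i \<in> {1..t}" "j \<in> {1..t}" "pick i = pick j"
  show "i = j"
  proof (cases "R j = {}")
    case True
    then show ?thesis using pick_eq_p[OF ij(1), of j] pick_p[of j] ij R_empty[of j] by auto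
  next
    case False
    then show ?thesis using pick_mem_R[OF ij(1,2)] pick_R[of j] ij by auto
  qed
qed

text \<open>The second alternative is the exceptional one: the right end p_{b+1} of the join
  represents cycle b + 1 when that cycle has no private element.\<close>

lemma pick_mem_join:
  assumes "1 \<le> a" "a \<le> b" "b \<le> t" "i \<in> {1..t}" "pick i \<in> join_cycles a b"
  shows "i \<in> {a..b} \<or> i = b + 1 \<and> b < t \<and> R i = {}"
proof -
  consider l where "l \<in> {a..b}" "pick i \<in> R l" | "2 \<le> a" "pick i = p a" | "b < t" "pick i = p (b + 1)"
    using assms(5) unfolding join_eq[OF assms(1-3)] by (auto split: if_splits)
  then show ?thesis
  proof cases
    case 1
    then show ?thesis using pick_mem_R[OF assms(4), of l] assms by auto
  next
    case 2
    then show ?thesis using pick_eq_p[OF assms(4), of a] assms by auto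
  next
    case 3
    then show ?thesis using pick_eq_p[OF assms(4), of "b + 1"] assms by auto
  qed
qed

lemma pick_in_join: "1 \<le> a \<Longrightarrow> a \<le> b \<Longrightarrow> b \<le> t \<Longrightarrow> pick a \<in> join_cycles a b"
  using pick_R[of a] pick_p[of a] R_empty[of a] by (cases "R a = {}") (auto simp: join_eq)

sublocale signed_circuits N csign "range lin"
proof
  show "finite (gnd N)" by (rule finite_gnd_N)
next
  fix C assume "C \<in> circuits N"
  then show "C \<subseteq> gnd N" by (metis circuit_cases join_subset_gnd)
next
  fix C assume "C \<in> circuits N"
  then show "C \<noteq> {}" by (metis circuit_cases pick_in_join empty_iff)
next
  fix C x assume C: "C \<in> circuits N" "x \<in> C"
  from csign[OF C(1)] C(2) show "csign C x \<in> {1, -1}" using lin_indicator(1) by metis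
next
  fix C x assume C: "C \<in> circuits N" "x \<notin> C"
  from csign[OF C(1)] C(2) show "csign C x = 0" using lin_indicator(2) by metis
next
  fix C assume "C \<in> circuits N"
  then show "csign C \<in> range lin" by (rule csign) auto
next
  fix z z' :: "'a \<Rightarrow> int" and c assume "z \<in> range lin" "z' \<in> range lin"
  then obtain d d' where "z = lin d" "z' = lin d'" by blast
  then have "(\<lambda>x. z x - c * z' x) = lin (\<lambda>i. d i - c * d' i)" by (simp add: lin_diff)
  then show "(\<lambda>x. z x - c * z' x) \<in> range lin" by blast
next
  fix z :: "'a \<Rightarrow> int" and x assume "z \<in> range lin" "x \<notin> gnd N"
  then show "z x = 0" using lin_out by auto
next
  fix z :: "'a \<Rightarrow> int" and x assume "z \<in> range lin" "z x \<noteq> 0"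
  then obtain c where z: "z = lin c" "lin c x \<noteq> 0" by auto
  from lin_support[OF z(2)] show "\<exists>C\<in>circuits N. \<forall>y\<in>C. z y \<noteq> 0" unfolding circuits_N z(1) by blast
qed

definition B :: "'a set" where "B = gnd N - pick ` {1..t}"

text \<open>\<open>E i\<close> alone may contain p_{i+1} as representative of cycle i + 1, which is
  not in \<open>B\<close>. Joining the following cycles without private elements cancels these
  elements, so the fundamental circuit of \<open>pick i\<close> extends to the end of their
  run.\<close>

definition last_idx :: "nat \<Rightarrow> nat" where
  "last_idx i = (GREATEST j. i \<le> j \<and> j \<le> t \<and> (\<forall>l\<in>{i<..j}. R l = {}))"

lemma last_idx:
  assumes "i \<in> {1..t}"
  shows "i \<le> last_idx i" "last_idx i \<le> t" "\<And>l. i < l \<Longrightarrow> l \<le> last_idx i \<Longrightarrow> R l = {}"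
    and "last_idx i < t \<Longrightarrow> R (last_idx i + 1) \<noteq> {}"
proof -
  let ?P = "\<lambda>j. i \<le> j \<and> j \<le> t \<and> (\<forall>l\<in>{i<..j}. R l = {})"
  have *: "?P (last_idx i)" unfolding last_idx_def by (rule GreatestI_nat[of ?P i t]) (use assms in auto)
  then show "i \<le> last_idx i" "last_idx i \<le> t" "\<And>l. i < l \<Longrightarrow> l \<le> last_idx i \<Longrightarrow> R l = {}" by auto
  show "R (last_idx i + 1) \<noteq> {}" if "last_idx i < t"
  proof
    assume "R (last_idx i + 1) = {}"
    then have "R l = {}" if "l \<in> {i<..last_idx i + 1}" for l using * that by (cases "l = last_idx i + 1") auto
    then have "?P (last_idx i + 1)" using * \<open>last_idx i < t\<close> by auto
    then have "last_idx i + 1 \<le> (GREATEST j. ?P j)" by (rule Greatest_le_nat[of ?P _ t]) blast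
    then show False unfolding last_idx_def[symmetric] by linarith
  qed
qed

lemma last_idx_eq:
  assumes "i \<in> {1..t}" "i \<le> b" "b \<le> t" "\<And>l. i < l \<Longrightarrow> l \<le> b \<Longrightarrow> R l = {}" "b < t \<Longrightarrow> R (b + 1) \<noteq> {}"
  shows "last_idx i = b"
proof (rule ccontr)
  assume "last_idx i \<noteq> b"
  then consider "last_idx i < b" | "b < last_idx i" by linarith
  then show False
    by cases (use last_idx[OF assms(1)] assms in \<open>auto dest: spec[of _ "b + 1"]\<close>)
qed

text \<open>Any further representative in the join would belong to a cycle without private elements
  inside the run, hence be an interior shared element, which the join removes.\<close>

lemma join_last_subset: "i \<in> {1..t} \<Longrightarrow> join_cycles i (last_idx i) \<subseteq> insert (pick i) B"
proof
  fix x assume i: "i \<in> {1..t}" and x: "x \<in> join_cycles i (last_idx i)"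
  note l = last_idx[OF i]
  have i1: "1 \<le> i" using i by auto
  have "x \<in> gnd N" using x l i unfolding join_cycles_def gnd_N by auto
  moreover have "k = i" if k: "k \<in> {1..t}" "x = pick k" for k
  proof -
    have "k \<in> {i..last_idx i} \<or> k = last_idx i + 1 \<and> last_idx i < t \<and> R k = {}"
      using pick_mem_join[OF i1 l(1,2) k(1)] x k(2) by simp
    then have k2: "k \<in> {i..last_idx i}" using l(4) by auto
    show ?thesis
    proof (rule ccontr)
      assume "k \<noteq> i"
      then have Rk: "R k = {}" and "i < k" using l(3) k2 by auto
      then have pk: "x = p k" "k \<in> {2..t}" using pick_p k R_empty[of k] by auto
      then show False using p_mem_join[OF pk(2) i1 l(1,2)] x k2 \<open>i < k\<close> by auto
    qed
  qed
  ultimately show "x \<in> insert (pick i) B" unfolding B_def by auto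
qed

lemma B_indep: "indep N B"
  unfolding indep_def
proof (intro conjI notI)
  show "B \<subseteq> gnd N" by (auto simp: B_def)
  assume "\<exists>C\<in>circuits N. C \<subseteq> B"
  then obtain a b where "1 \<le> a" "a \<le> b" "b \<le> t" "join_cycles a b \<subseteq> B" by (metis circuit_cases)
  then show False using pick_in_join[of a b] unfolding B_def by auto
qed

lemma join_circuit: "1 \<le> a \<Longrightarrow> a \<le> b \<Longrightarrow> b \<le> t \<Longrightarrow> join_cycles a b \<in> circuits N"
  unfolding circuits_N by blast

lemma B_basis: "is_basis N B"
  unfolding is_basis_def
proof (intro conjI B_indep allI impI)
  fix I assume I: "indep N I" "B \<subseteq> I"
  show "I = B"
  proof (rule ccontr)
    assume "I \<noteq> B"
    then obtain i where i: "i \<in> {1..t}" "pick i \<in> I" using I unfolding indep_def B_def by blast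
    then have "join_cycles i (last_idx i) \<subseteq> I" using join_last_subset[of i] I by auto
    moreover have "join_cycles i (last_idx i) \<in> circuits N"
      using join_circuit[of i "last_idx i"] last_idx[OF i(1)] i by auto
    ultimately show False using I unfolding indep_def by auto
  qed
qed

lemma fund_ci_pick: "i \<in> {1..t} \<Longrightarrow> fund_ci N B (pick i) = join_cycles i (last_idx i)"
  using join_circuit[of i "last_idx i"] last_idx[of i] join_last_subset[of i]
  by (intro fund_ci_eq[OF B_indep]) auto

section \<open>The rank\<close>

text \<open>If \<open>T\<close> has an element in the last cycle that lies in no earlier one, drop
  that cycle. Otherwise \<open>T\<close> meets it only in the gluing element p; removing p still
  leaves all earlier joins hit, since a join ending just before the last cycle can be extended
  through it, and the extended join, which omits p, must be hit in its earlier part.\<close>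

lemma transversal_card:
  assumes "j \<le> t" "finite T" "\<And>a b. 1 \<le> a \<Longrightarrow> a \<le> b \<Longrightarrow> b \<le> j \<Longrightarrow> T \<inter> join_cycles a b \<noteq> {}"
  shows "j \<le> card (T \<inter> \<Union> (E ` {1..j}))"
  using assms
proof (induction j arbitrary: T)
  case (Suc j)
  let ?k = "Suc j" and ?U = "\<Union> (E ` {1..j})"
  have U: "\<Union> (E ` {1..?k}) = ?U \<union> E ?k" by (auto simp: atLeastAtMostSuc_conv)
  show ?case
  proof (cases "T \<inter> (E ?k - ?U) = {}")
    case False
    have "j \<le> card (T \<inter> ?U)" using Suc by auto
    moreover have "card (T \<inter> (E ?k - ?U)) \<ge> 1" using False Suc.prems(2) by (simp add: Suc_leI card_gt_0_iff)
    moreover have "T \<inter> \<Union> (E ` {1..?k}) = (T \<inter> ?U) \<union> (T \<inter> (E ?k - ?U))" unfolding U by auto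
    moreover have "card ((T \<inter> ?U) \<union> (T \<inter> (E ?k - ?U))) = card (T \<inter> ?U) + card (T \<inter> (E ?k - ?U))"
      using Suc.prems(2) by (intro card_Un_disjoint) auto
    ultimately show ?thesis by simp
  next
    case True
    have "join_cycles ?k ?k = E ?k" by (simp add: join_cycles_def)
    then have ne: "T \<inter> E ?k \<noteq> {}" using Suc.prems(3)[of ?k ?k] by simp
    then have j: "j \<ge> 1" using True by (cases j) auto
    have "?U \<inter> E ?k \<subseteq> {p ?k}"
    proof
      fix x assume "x \<in> ?U \<inter> E ?k"
      then obtain l where l: "l \<in> {1..j}" "x \<in> E l" "x \<in> E ?k" by auto
      have "l = j"
      proof (rule ccontr)
        assume "l \<noteq> j"
        then have "E l \<inter> E ?k = {}" using apart[of l ?k] l(1) Suc.prems(1) by auto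
        with l show False by blast
      qed
      moreover have "E j \<inter> E ?k = {p ?k}" using consecutive[of j] j Suc.prems(1) by fastforce
      ultimately show "x \<in> {p ?k}" using l by blast
    qed
    with True ne have TE: "T \<inter> E ?k = {p ?k}" by blast
    let ?T = "T - {p ?k}"
    have "?T \<inter> join_cycles a b \<noteq> {}" if ab: "1 \<le> a" "a \<le> b" "b \<le> j" for a b
    proof (cases "b = j")
      case False
      then have "p ?k \<notin> join_cycles a b" using p_mem_join[of ?k a b] ab Suc.prems(1) j by auto
      then show ?thesis using Suc.prems(3)[of a b] ab by auto
    next
      case b: True
      obtain x where x: "x \<in> T" "x \<in> join_cycles a ?k" using Suc.prems(3)[of a ?k] ab by auto
      then have "x \<in> join_cycles a j \<union> E ?k - {p ?k}" using join_Suc[of a j] ab Suc.prems(1) b by auto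
      then show ?thesis using x(1) TE b by auto
    qed
    then have "j \<le> card (?T \<inter> ?U)" using Suc.IH[of ?T] Suc.prems by auto
    moreover have "p ?k \<in> T \<inter> ?U" using TE p_mem(1)[of ?k] j Suc.prems(1) by auto
    then have "card (T \<inter> ?U) = Suc (card (?T \<inter> ?U))"
      using Suc.prems(2) card_Suc_Diff1[of "T \<inter> ?U" "p ?k"] by (simp add: Int_Diff Diff_Int_distrib2)
    moreover have "card (T \<inter> ?U) \<le> card (T \<inter> \<Union> (E ` {1..?k}))"
      using Suc.prems(2) unfolding U by (intro card_mono) auto
    ultimately show ?thesis by simp
  qed
qed simp

lemma card_B: "card B = card (gnd N) - t" and t_le: "t \<le> card (gnd N)"
proof -
  have sub: "pick ` {1..t} \<subseteq> gnd N" using pick_gnd by auto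
  have c: "card (pick ` {1..t}) = t" using card_image[OF inj_pick] by simp
  show "card B = card (gnd N) - t" unfolding B_def using card_Diff_subset[OF _ sub] c by simp
  show "t \<le> card (gnd N)" using card_mono[OF finite_gnd_N sub] c by simp
qed

text \<open>\<open>B\<close> gives the lower bound. For the upper bound, the complement of an
  independent set meets every circuit and therefore has at least t elements.\<close>

lemma mrank_N: "mrank N = card (gnd N) - t"
proof -
  have "card I \<le> card (gnd N) - t" if I: "indep N I" for I
  proof -
    have "t \<le> card ((gnd N - I) \<inter> \<Union> (E ` {1..t}))"
    proof (rule transversal_card)
      fix a b assume ab: "1 \<le> a" "a \<le> b" "b \<le> t"
      then have "join_cycles a b \<in> circuits N" by (rule join_circuit)
      then show "(gnd N - I) \<inter> join_cycles a b \<noteq> {}" using I circuit_subset unfolding indep_def by blast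
    qed (use finite_gnd_N in auto)
    also have "\<dots> \<le> card (gnd N - I)" using finite_gnd_N by (intro card_mono) auto
    also have "\<dots> = card (gnd N) - card I" using I finite_gnd_N indep_finite[OF I]
      by (intro card_Diff_subset) (auto simp: indep_def)
    finally show ?thesis using card_mono[OF finite_gnd_N, of I] I unfolding indep_def by linarith
  qed
  then have le: "k \<le> card (gnd N) - t" if "k \<in> {card I | I. indep N I}" for k using that by blast
  then have "finite {card I | I. indep N I}" by (meson atMost_iff finite_atMost finite_subset subsetI)
  moreover have "card (gnd N) - t \<in> {card I | I. indep N I}" using B_indep card_B[symmetric] by blast
  ultimately show ?thesis unfolding mrank_def using le by (intro Max_eqI)
qed

section \<open>Sizes and products of broken circuits\<close>

abbreviation "s \<equiv> \<lambda>i. card (R i)"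
abbreviation "m \<equiv> card (gnd N)"

lemma s_zero_iff: "i \<in> {1..t} \<Longrightarrow> s i = 0 \<longleftrightarrow> R i = {}"
  using finite_R by simp

lemma finite_join: "1 \<le> a \<Longrightarrow> b \<le> t \<Longrightarrow> finite (join_cycles a b)"
  using join_subset_gnd finite_gnd_N finite_subset by blast

lemma p_pick: "k \<in> {2..t} \<Longrightarrow> R k \<noteq> {} \<Longrightarrow> p k \<in> B"
  using pick_eq_p[of _ k] p_gnd[of k] unfolding B_def by (metis Diff_iff imageE)

lemma R_pick: "l \<in> {1..t} \<Longrightarrow> x \<in> R l \<Longrightarrow> x \<noteq> pick l \<Longrightarrow> x \<in> B"
  using pick_mem_R[of _ l] R_gnd[of l x] unfolding B_def by (metis Diff_iff imageE)

lemma last_idx_less_iff: "i \<in> {1..t} \<Longrightarrow> last_idx i < t \<longleftrightarrow> i < t"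
  using last_idx(1-3)[of i] R_empty[of t] t_pos by (metis atLeastAtMost_iff le_neq_implies_less less_irrefl order_le_less_trans order_refl)

text \<open>The cycles joined after cycle i have no private elements; they only move the right end
  from p_{i+1} to a later p, so the circuit has the size of \<open>E i\<close>.\<close>

lemma card_fund_circuit:
  assumes "i \<in> {1..t}"
  shows "card (join_cycles i (last_idx i) - {pick i}) = n i - 1"
proof -
  note l = last_idx[OF assms]
  have i1: "1 \<le> i" using assms by auto
  have "{i..last_idx i} = insert i {i<..last_idx i}" using l(1) by auto
  moreover have "\<Union> (R ` {i<..last_idx i}) = {}" using l(3) by simp
  ultimately have "\<Union> (R ` {i..last_idx i}) = R i" by simp
  then have eq: "join_cycles i (last_idx i) = R i \<union> (if 2 \<le> i then {p i} else {}) \<union> (if i < t then {p (last_idx i + 1)} else {})"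
    using join_eq[OF i1 l(1,2)] last_idx_less_iff[OF assms] by simp
  have "p i \<notin> R i" if "2 \<le> i" using R_p assms that by auto
  moreover have "p (last_idx i + 1) \<notin> R i" if "i < t" using R_p i1 l(1) last_idx_less_iff[OF assms] that by auto
  moreover have "p i \<noteq> p (last_idx i + 1)" if "2 \<le> i" "i < t"
    using p_same[of i "last_idx i + 1"] l(1) last_idx_less_iff[OF assms] that by auto
  ultimately have "card (join_cycles i (last_idx i)) = s i + (if 2 \<le> i then 1 else 0) + (if i < t then 1 else 0)"
    unfolding eq using finite_R[OF assms] by (auto simp: card_insert_if)
  then show ?thesis using n_eq[OF assms] pick_in_join[OF i1 l(1,2)] by (simp add: card_Diff_singleton)
qed

text \<open>This is the origin of \<open>chain_head\<close> and \<open>chain_tail\<close>: the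
  product splits into the first cycle with p_a, the later private elements, and the right
  end.\<close>

lemma prod_lin_broken_circuit:
  fixes c :: "nat \<Rightarrow> 'r::comm_ring_1"
  assumes ab: "1 \<le> a" "a \<le> b" "b \<le> t"
  shows "(\<Prod>x\<in>join_cycles a b - {pick a}. lin c x) =
    (if R a = {} then 1 else (if 2 \<le> a then c a - c (a - 1) else 1) * c a ^ (s a - 1)) *
    ((\<Prod>l\<in>{a<..b}. c l ^ s l) * (if b < t then c (b + 1) - c b else 1))"
proof -
  let ?pa = "if 2 \<le> a then {p a} else {}" and ?pb = "if b < t then {p (b + 1)} else {}"
  let ?A1 = "R a \<union> ?pa - {pick a}" and ?A2 = "\<Union>l\<in>{a<..b}. R l"
  have a: "a \<in> {1..t}" using ab by auto
  have fin: "finite (R l)" if "l \<in> {a..b}" for l using finite_R[of l] that ab by auto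
  have pickA2: "pick a \<notin> ?A2"
  proof
    assume "pick a \<in> ?A2"
    then obtain l where "l \<in> {a<..b}" "pick a \<in> R l" by blast
    then show False using pick_mem_R[OF a, of l] ab by auto
  qed
  have pickpb: "pick a \<notin> ?pb" using pick_eq_p[OF a, of "b + 1"] ab by auto
  have "{a..b} = insert a {a<..b}" using ab by auto
  then have eq: "join_cycles a b - {pick a} = ?A1 \<union> (?A2 \<union> ?pb)"
    using pickA2 pickpb unfolding join_eq[OF ab] by auto
  have "R a \<inter> R l = {}" if "l \<in> {a<..b}" for l using R_disjoint[OF a, of l] that ab by auto
  then have d1: "R a \<inter> ?A2 = {}" by blast
  have d2: "?pa \<inter> ?A2 = {}" using R_p[of a] a by auto
  have d3: "?pb \<inter> (R a \<union> ?A2) = {}" using R_p[of "b + 1"] ab by auto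
  have d4: "?pa \<inter> ?pb = {}" using p_same[of a "b + 1"] ab by auto
  have "(\<Prod>x\<in>join_cycles a b - {pick a}. lin c x) = (\<Prod>x\<in>?A1. lin c x) * (\<Prod>x\<in>?A2 \<union> ?pb. lin c x)"
    unfolding eq by (rule prod.union_disjoint) (use fin ab d1 d2 d3 d4 in auto)
  also have "(\<Prod>x\<in>?A2 \<union> ?pb. lin c x) = (\<Prod>x\<in>?A2. lin c x) * (\<Prod>x\<in>?pb. lin c x)"
    by (rule prod.union_disjoint) (use fin d3 in auto)
  also have "(\<Prod>x\<in>?A2. lin c x) = (\<Prod>l\<in>{a<..b}. \<Prod>x\<in>R l. lin c x)"
    by (rule prod.UNION_disjoint) (use fin R_disjoint ab in auto)
  also have "\<dots> = (\<Prod>l\<in>{a<..b}. c l ^ s l)"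
  proof (intro prod.cong refl)
    fix l assume "l \<in> {a<..b}"
    then have "(\<Prod>x\<in>R l. lin c x) = (\<Prod>x\<in>R l. c l)" using ab by (intro prod.cong refl lin_R) auto
    then show "(\<Prod>x\<in>R l. lin c x) = c l ^ s l" by simp
  qed
  also have "(\<Prod>x\<in>?pb. lin c x) = (if b < t then c (b + 1) - c b else 1)"
    using lin_p[of "b + 1" c] ab by auto
  also have "(\<Prod>x\<in>?A1. lin c x) =
    (if R a = {} then 1 else (if 2 \<le> a then c a - c (a - 1) else 1) * c a ^ (s a - 1))"
  proof (cases "R a = {}")
    case True
    then show ?thesis using pick_p[of a] by auto
  next
    case False
    have pa: "p a \<noteq> pick a" if "2 \<le> a" using pick_eq_p[OF a, of a] False that a by auto
    have "?A1 = ?pa \<union> (R a - {pick a})" using pa by auto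
    then have "(\<Prod>x\<in>?A1. lin c x) = (\<Prod>x\<in>?pa. lin c x) * (\<Prod>x\<in>R a - {pick a}. lin c x)"
      using R_p[of a a] a finite_R[OF a] by (simp only:) (rule prod.union_disjoint, auto)
    also have "(\<Prod>x\<in>R a - {pick a}. lin c x) = (\<Prod>x\<in>R a - {pick a}. c a)"
      by (intro prod.cong refl) (use lin_R[OF a] in auto)
    also have "\<dots> = c a ^ (s a - 1)"
      using pick_R[OF False] finite_R[OF a] by (simp add: card_Diff_singleton)
    finally show ?thesis using lin_p[of a c] a False by auto
  qed
  finally show ?thesis .
qed

lemma ordering_exists: "\<exists>e. bij_betw e {1..m} (gnd N) \<and> (\<forall>i\<in>{1..t}. e i = pick i)"
proof -
  have "card {t<..m} = card B" using card_B by simp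
  moreover have "finite B" unfolding B_def using finite_gnd_N by simp
  ultimately obtain g where g: "bij_betw g {t<..m} B" using finite_same_card_bij[of "{t<..m}" B] by auto
  let ?e = "\<lambda>i. if i \<le> t then pick i else g i"
  have "bij_betw pick {1..t} (pick ` {1..t})" using inj_pick by (rule inj_on_imp_bij_betw)
  then have "bij_betw ?e {1..t} (pick ` {1..t})" by (rule bij_betw_cong[THEN iffD1, rotated]) auto
  moreover have "bij_betw ?e {t<..m} B" using g by (rule bij_betw_cong[THEN iffD1, rotated]) auto
  ultimately have "bij_betw ?e ({1..t} \<union> {t<..m}) (pick ` {1..t} \<union> B)"
    by (rule bij_betw_combine) (auto simp: B_def)
  moreover have "{1..t} \<union> {t<..m} = {1..m}" using t_le by auto
  moreover have "pick ` {1..t} \<union> B = gnd N" using pick_gnd unfolding B_def by auto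
  ultimately show ?thesis by (intro exI[of _ ?e]) auto
qed

end

section \<open>The ordering and the monomials m_C\<close>

locale ordered_chain = cycle_chain +
  fixes e :: "nat \<Rightarrow> 'a"
  assumes e_bij: "bij_betw e {1..card (gnd N)} (gnd N)"
    and e_pick: "i \<in> {1..t} \<Longrightarrow> e i = pick i"
begin

abbreviation "idx \<equiv> elt_idx e m"

lemma idx_e: "i \<in> {1..m} \<Longrightarrow> idx (e i) = i"
  unfolding elt_idx_def using e_bij[THEN bij_betw_imp_inj_on] by (blast intro: the_equality dest: inj_onD)

lemma e_idx: "x \<in> gnd N \<Longrightarrow> idx x \<in> {1..m} \<and> e (idx x) = x"
proof -
  assume "x \<in> gnd N"
  then obtain i where "i \<in> {1..m}" "x = e i" using bij_betw_imp_surj_on[OF e_bij] by blast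
  then show ?thesis using idx_e[of i] by simp
qed

lemma idx_pick: "i \<in> {1..t} \<Longrightarrow> idx (pick i) = i"
  using idx_e[of i] e_pick[of i] t_le by auto

lemma m_minus_rank: "m - mrank N = t"
  using mrank_N t_le by simp

lemma e_B: "e ` {t + 1..m} = B"
proof -
  have "e ` {1..t} = pick ` {1..t}" using e_pick by auto
  moreover have "{t + 1..m} = {1..m} - {1..t}" using t_le by auto
  moreover have "inj_on e {1..m}" "e ` {1..m} = gnd N" using e_bij by (auto simp: bij_betw_def)
  ultimately show ?thesis unfolding B_def
    by (metis Diff_subset atLeastatMost_subset_iff inj_on_image_set_diff le_refl t_le)
qed

text \<open>Elements of \<open>B\<close> come after position t, and a representative in the join has
  index at least a.\<close>

lemma cmin_join:
  assumes ab: "1 \<le> a" "a \<le> b" "b \<le> t"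
  shows "cmin e m (join_cycles a b) = join_cycles a b - {pick a}"
proof -
  have "Min (idx ` join_cycles a b) = a"
  proof (rule Min_eqI)
    show "finite (idx ` join_cycles a b)" using finite_join ab by auto
    show "a \<in> idx ` join_cycles a b" using pick_in_join[OF ab] idx_pick[of a] ab by force
    fix k assume "k \<in> idx ` join_cycles a b"
    then obtain x where x: "x \<in> join_cycles a b" "k = idx x" by auto
    then have k: "k \<in> {1..m}" "e k = x" using e_idx join_subset_gnd ab by auto
    show "a \<le> k"
    proof (cases "k \<le> t")
      case True
      then have kt: "k \<in> {1..t}" using k by auto
      then show ?thesis using pick_mem_join[OF ab kt] e_pick[OF kt] x(1) k(2) ab by auto
    qed (use ab in auto)
  qed
  then show ?thesis unfolding cmin_def using e_pick[of a] ab by simp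
qed

abbreviation "dv \<equiv> \<lambda>x. dval N e (idx x)"

lemma dv_pick: "i \<in> {1..t} \<Longrightarrow> dv (pick i) = i"
  by (simp add: idx_pick dval_def m_minus_rank)

text \<open>Apart from x, whose index exceeds t, the fundamental cocircuit of x consists of the
  representatives whose fundamental circuits contain x.\<close>

lemma dv_B:
  assumes x: "x \<in> B" and l: "l \<in> {1..t}" "x \<in> join_cycles l (last_idx l)"
    and least: "\<And>i. i \<in> {1..t} \<Longrightarrow> x \<in> join_cycles i (last_idx i) \<Longrightarrow> l \<le> i"
  shows "dv x = l"
proof -
  have xg: "x \<in> gnd N" using x by (auto simp: B_def)
  have notpick: "\<not> idx x \<le> t" using e_idx[OF xg] e_pick[of "idx x"] x by (auto simp: B_def)
  let ?S = "{i \<in> {1..m}. e i \<in> fund_coc N B x}"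
  have coc: "fund_coc N B x = insert x {y \<in> gnd N - B. x \<in> fund_ci N B y}"
    by (rule fund_coc_eq[OF B_basis x])
  have NB: "gnd N - B = pick ` {1..t}" using pick_gnd unfolding B_def by auto
  have "Min ?S = l"
  proof (rule Min_eqI)
    show "finite ?S" by simp
    have "pick l \<in> fund_coc N B x" unfolding coc NB using l fund_ci_pick[OF l(1)] by auto
    then show "l \<in> ?S" using l(1) e_pick[OF l(1)] t_le by auto
    fix i assume i: "i \<in> ?S"
    then have ei: "e i \<in> fund_coc N B x" and im: "i \<in> {1..m}" by auto
    show "l \<le> i"
    proof (cases "i \<le> t")
      case True
      then have it: "i \<in> {1..t}" using im by auto
      have "x \<noteq> pick i" using x it by (auto simp: B_def)
      then have "x \<in> fund_ci N B (pick i)" using ei unfolding coc e_pick[OF it] by auto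
      then show ?thesis using least[OF it] fund_ci_pick[OF it] by simp
    qed (use l in auto)
  qed
  moreover have "x = e (idx x)" using e_idx[OF xg] by simp
  ultimately show ?thesis
    using notpick unfolding dval_def Let_def m_minus_rank e_B by simp
qed

text \<open>The cycles joined after the first in a fundamental circuit have no private elements, so
  x lies in the fundamental circuit of its own cycle only.\<close>

lemma dv_R:
  assumes l: "l \<in> {1..t}" "x \<in> R l"
  shows "dv x = l"
proof (cases "x = pick l")
  case True
  then show ?thesis using dv_pick l by simp
next
  case False
  have mem: "x \<in> join_cycles i (last_idx i) \<longleftrightarrow> l = i" if i: "i \<in> {1..t}" for i
  proof
    note la = last_idx[OF i]
    have i1: "1 \<le> i" using i by auto
    assume "x \<in> join_cycles i (last_idx i)"
    then have "x \<in> \<Union> (R ` {i..last_idx i})" using R_p[of i l] R_p[of "last_idx i + 1" l] l(2) i la(1)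
      unfolding join_eq[OF i1 la(1,2)] by (auto split: if_splits)
    then obtain k where k: "k \<in> {i..last_idx i}" "x \<in> R k" by auto
    then have "k = i" using la(3)[of k] by (cases "k = i") auto
    then show "l = i" using R_same[of x l k] k l i by auto
  next
    assume "l = i"
    then show "x \<in> join_cycles i (last_idx i)" using l last_idx[OF i] i by (auto simp: join_eq)
  qed
  show ?thesis by (rule dv_B[OF R_pick[OF l False] l(1)]) (use mem l in auto)
qed

text \<open>The fundamental circuits through p_{b+1} either start at b + 1 or end at b. One that
  ends at b cannot start before l, because cycle l has private elements.\<close>

lemma dv_p:
  assumes l: "l \<in> {1..t}" "R l \<noteq> {}" and b: "l \<le> b" "b < t" "R (b + 1) \<noteq> {}"
    and empty: "\<And>k. l < k \<Longrightarrow> k \<le> b \<Longrightarrow> R k = {}"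
  shows "dv (p (b + 1)) = l"
proof (rule dv_B)
  have k: "b + 1 \<in> {2..t}" using l b by auto
  show "p (b + 1) \<in> B" using p_pick[OF k b(3)] .
  have la: "last_idx l = b" by (rule last_idx_eq) (use l b empty in auto)
  show "p (b + 1) \<in> join_cycles l (last_idx l)" unfolding la
    using p_mem_join[OF k, of l b] l b by auto
  fix i assume i: "i \<in> {1..t}" "p (b + 1) \<in> join_cycles i (last_idx i)"
  note li = last_idx[OF i(1)]
  have i1: "1 \<le> i" using i by auto
  have "b + 1 = i \<or> b = last_idx i" using p_mem_join[OF k i1 li(1,2)] i(2) by auto
  then show "l \<le> i"
  proof
    assume "b = last_idx i"
    then show ?thesis using li(3)[of l] l b(1) by (metis not_le)
  qed (use b in simp)
qed (rule l(1))

lemma mC_fund: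
  assumes i: "i \<in> {1..t}"
  shows "mC_exp N e (join_cycles i (last_idx i)) = single i (n i - 1)"
proof -
  note li = last_idx[OF i]
  have i1: "1 \<le> i" using i by auto
  have "(join_cycles i (last_idx i) = fund_ci N B (e k)) \<longleftrightarrow> k = i" if k: "k \<in> {1..t}" for k
  proof
    assume "join_cycles i (last_idx i) = fund_ci N B (e k)"
    then have "pick i \<in> insert (pick k) B" using fund_ci_pick[OF k] e_pick[OF k] join_last_subset[OF k]
      pick_in_join[OF i1 li(1,2)] by auto
    moreover have "pick i \<notin> B" using i by (auto simp: B_def)
    ultimately have "pick i = pick k" by auto
    then show "k = i" using inj_onD[OF inj_pick] i k by metis
  qed (use fund_ci_pick[OF i] e_pick[OF i] in simp)
  then have "(THE k. k \<in> {1..t} \<and> join_cycles i (last_idx i) = fund_ci N B (e k)) = i"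
    and "\<exists>k\<in>{1..t}. join_cycles i (last_idx i) = fund_ci N B (e k)"
    using i by (auto intro!: the_equality)
  then show ?thesis unfolding mC_exp_def Let_def m_minus_rank e_B
    using cmin_join[OF i1 li(1,2)] card_fund_circuit[OF i] by simp
qed

text \<open>Divisibility by some x_l to the power n_l - 1 means that no circuit outside the
  fundamental ones shrinks the box. The index l is b + 1 if that cycle has no private elements, and
  otherwise the last cycle of the interval that has some: its private elements and p_{b+1} all have
  d-value l.\<close>

lemma mC_other:
  assumes ab: "1 \<le> a" "a \<le> b" "b \<le> t" and other: "\<And>i. i \<in> {1..t} \<Longrightarrow> join_cycles a b \<noteq> join_cycles i (last_idx i)"
  shows "\<exists>l\<in>{1..t}. n l - 1 \<le> lookup (mC_exp N e (join_cycles a b)) l"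
proof -
  let ?X = "join_cycles a b - {pick a}"
  have a: "a \<in> {1..t}" using ab by auto
  have fin: "finite ?X" using finite_join ab by auto
  have "\<not> (\<exists>i\<in>{1..t}. join_cycles a b = fund_ci N B (e i))"
    using other fund_ci_pick e_pick by auto
  then have mC: "mC_exp N e (join_cycles a b) = (\<Sum>x\<in>?X. single (dv x) 1)"
    unfolding mC_exp_def Let_def m_minus_rank e_B using cmin_join[OF ab] by simp
  have lookup: "card Y \<le> lookup (mC_exp N e (join_cycles a b)) l" if "Y \<subseteq> ?X" "\<And>x. x \<in> Y \<Longrightarrow> dv x = l" for Y l
    unfolding mC lookup_sum_single[OF fin] using that fin by (intro card_mono) auto
  show ?thesis
  proof (cases "b < t \<and> R (b + 1) = {}")
    case True
    have k: "b + 1 \<in> {1..t}" "b + 1 \<in> {2..t}" using ab True by auto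
    have "p (b + 1) \<noteq> pick a" using pick_eq_p[OF a k(2)] ab by auto
    moreover have "p (b + 1) \<in> join_cycles a b" using p_mem_join[OF k(2) ab] by simp
    moreover have "dv (p (b + 1)) = b + 1" using dv_pick[OF k(1)] pick_p[of "b + 1"] True by simp
    ultimately have "card {p (b + 1)} \<le> lookup (mC_exp N e (join_cycles a b)) (b + 1)" by (intro lookup) auto
    \<comment> \<open>A cycle without private elements has at most two elements, so the single
      factor from p_{b+1} reaches the bound.\<close>
    moreover have "n (b + 1) - 1 \<le> 1" using n_eq[OF k(1)] True by auto
    ultimately show ?thesis using k(1) by (intro bexI[of _ "b + 1"]) auto
  next
    case False
    then have next_ne: "b < t \<Longrightarrow> R (b + 1) \<noteq> {}" by auto
    \<comment> \<open>Otherwise the interval would end at \<open>last_idx a\<close> and the circuit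
      would be fundamental.\<close>
    have "\<exists>l\<in>{a<..b}. R l \<noteq> {}"
    proof (rule ccontr)
      assume "\<not> ?thesis"
      then have "last_idx a = b" using next_ne ab by (intro last_idx_eq[OF a]) auto
      then show False using other[OF a] by simp
    qed
    then have ex: "\<exists>l. l \<in> {a<..b} \<and> R l \<noteq> {}" by blast
    define l where "l = (GREATEST l. l \<in> {a<..b} \<and> R l \<noteq> {})"
    have l: "l \<in> {a<..b}" "R l \<noteq> {}"
      using GreatestI_ex_nat[OF ex, of b] unfolding l_def by auto
    have empty: "R k = {}" if "l < k" "k \<le> b" for k
    proof (rule ccontr)
      assume "R k \<noteq> {}"
      then have "k \<le> (GREATEST l. l \<in> {a<..b} \<and> R l \<noteq> {})" using that l
        by (intro Greatest_le_nat[of _ k b]) auto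
      then show False using that unfolding l_def[symmetric] by simp
    qed
    have lt: "l \<in> {1..t}" using l ab by auto
    have "l \<in> {a..b}" using l by auto
    then have "R l \<subseteq> join_cycles a b" unfolding join_eq[OF ab] by blast
    moreover have "pick a \<notin> R l" using pick_mem_R[OF a lt] l by auto
    ultimately have Rl: "R l \<subseteq> ?X" by blast
    show ?thesis
    proof (cases "b < t")
      case True
      have k: "b + 1 \<in> {2..t}" using ab True by auto
      have "p (b + 1) \<in> ?X" using p_mem_join[OF k ab] pick_eq_p[OF a k] ab by auto
      moreover have "dv (p (b + 1)) = l" using l True next_ne empty by (intro dv_p[OF lt]) auto
      ultimately have "card (insert (p (b + 1)) (R l)) \<le> lookup (mC_exp N e (join_cycles a b)) l"
        using Rl dv_R[OF lt] by (intro lookup) auto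
      moreover have "card (insert (p (b + 1)) (R l)) = s l + 1" using R_p[OF k] finite_R[OF lt] by simp
      moreover have "n l - 1 \<le> s l + 1" using n_eq[OF lt] by auto
      ultimately show ?thesis using lt by (intro bexI[of _ l]) auto
    next
      case False
      then have "b = t" using ab by simp
      \<comment> \<open>The last cycle has private elements and no right shared element, so l = t
        and its private elements alone reach the bound.\<close>
      have "R t \<noteq> {}" using R_empty[of t] t_pos by auto
      then have "l = t" using empty[of t] l \<open>b = t\<close> by (metis greaterThanAtMost_iff le_neq_implies_less order_refl)
      then have "n l - 1 \<le> s l" using n_eq[OF lt] by auto
      moreover have "card (R l) \<le> lookup (mC_exp N e (join_cycles a b)) l" by (rule lookup[OF Rl dv_R[OF lt]])
      ultimately show ?thesis using lt by (intro bexI[of _ l]) auto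
    qed
  qed
qed

section \<open>The set L as a box\<close>

text \<open>Cycle 1 has no left shared element and loses one private element as the minimum, so
  intervals starting there have a head of degree \<open>s 1 - 1\<close>.\<close>

abbreviation "box \<equiv> chain_box t s {} 1 (s 1 - 1)"

lemma box_eq: "box l = (if l \<in> {1..t} then {..<n l - 1} else {0})"
proof (cases "l \<in> {1..t}")
  case True
  \<comment> \<open>An end cycle has a private element, so the subtraction in \<open>s 1 - 1\<close>
    is not truncated.\<close>
  have "s 1 \<ge> 1" using R_empty[of 1] finite_R[of 1] t_pos by (simp add: Suc_le_eq card_gt_0_iff) fastforce
  then show ?thesis using True n_eq[OF True] unfolding chain_box_def Let_def by auto
qed (auto simp: chain_box_def)

lemma L_set_eq: "L_set N e = {a. \<forall>l. lookup a l \<in> box l}"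
proof (intro set_eqI iffI)
  fix a assume a: "a \<in> L_set N e"
  have keys: "keys a \<subseteq> {1..t}" using a unfolding L_set_def m_minus_rank by blast
  have "lookup a l < n l - 1" if l: "l \<in> {1..t}" for l
  proof -
    have "join_cycles l (last_idx l) \<in> circuits N" using join_circuit[of l "last_idx l"] last_idx[OF l] l by auto
    then have "\<not> divides_exp (mC_exp N e (join_cycles l (last_idx l))) a" using a unfolding L_set_def by blast
    then obtain k where "\<not> lookup (single l (n l - 1)) k \<le> lookup a k"
      unfolding divides_exp_def mC_fund[OF l] by blast
    then show ?thesis by (cases "k = l") (auto simp: lookup_single)
  qed
  then show "a \<in> {a. \<forall>l. lookup a l \<in> box l}" using keys unfolding box_eq by (auto simp: in_keys_iff)
next
  fix a assume "a \<in> {a. \<forall>l. lookup a l \<in> box l}"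
  then have a: "lookup a l \<in> (if l \<in> {1..t} then {..<n l - 1} else {0})" for l unfolding box_eq by blast
  have "keys a \<subseteq> {1..t}"
  proof
    fix l assume "l \<in> keys a"
    then show "l \<in> {1..t}" using a[of l] by (auto simp: in_keys_iff split: if_splits)
  qed
  moreover have "\<not> divides_exp (mC_exp N e C) a" if "C \<in> circuits N" for C
  proof -
    obtain x y where xy: "1 \<le> x" "x \<le> y" "y \<le> t" "C = join_cycles x y" using \<open>C \<in> circuits N\<close> by (rule circuit_cases)
    have "\<exists>l\<in>{1..t}. n l - 1 \<le> lookup (mC_exp N e C) l"
    proof (cases "\<exists>i\<in>{1..t}. C = join_cycles i (last_idx i)")
      case True
      then obtain i where "i \<in> {1..t}" "C = join_cycles i (last_idx i)" by blast
      then show ?thesis using mC_fund[of i] by (intro bexI[of _ i]) auto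
    next
      case False
      then show ?thesis using mC_other[OF xy(1-3)] xy(4) by auto
    qed
    then obtain l where l: "l \<in> {1..t}" "n l - 1 \<le> lookup (mC_exp N e C) l" by blast
    then have "lookup a l < lookup (mC_exp N e C) l" using a[of l] by auto
    then show ?thesis unfolding divides_exp_def by (metis not_le)
  qed
  ultimately show "a \<in> L_set N e" unfolding L_set_def m_minus_rank by blast
qed

text \<open>The coordinate \<open>y\<^sub>i\<close> expressed through the variables \<open>x\<^sub>1,\<dots>,x\<^sub>t\<close> that survive modulo \<open>\<Theta>\<^sup>B\<close>.\<close>

primrec face_var :: "nat \<Rightarrow> ('k::comm_ring_1) mpoly" where
  "face_var 0 = 0"
| "face_var (Suc i) = (if R (Suc i) = {} then face_var i + var_poly (Suc i) else var_poly (Suc i))"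

lemma face_var_vars: "i \<le> t \<Longrightarrow> poly_in_vars {1..t} (face_var i)"
  by (induction i) auto

lemma face_var_R: "i \<in> {1..t} \<Longrightarrow> R i \<noteq> {} \<Longrightarrow> face_var i = var_poly i"
  by (cases i) auto

lemma lin_face_var_pick: "i \<in> {1..t} \<Longrightarrow> lin face_var (pick i) = (var_poly i :: ('k::comm_ring_1) mpoly)"
proof -
  assume i: "i \<in> {1..t}"
  show ?thesis
  proof (cases "R i = {}")
    case True
    then have i2: "i \<in> {2..t}" using R_empty[OF i] by auto
    have "face_var i = face_var (i - 1) + (var_poly i :: 'k mpoly)" using True i by (cases i) auto
    then show ?thesis by (simp add: pick_p[OF True] lin_p[OF i2])
  next
    case False
    then show ?thesis using lin_R[OF i pick_R[OF False]] face_var_R[OF i False] by metis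
  qed
qed

section \<open>Comparison with the quotient ring of the chain\<close>

lemma psubst_lin: "psubst h (lin var_poly x) = lin h x"
  unfolding lin_def by (simp add: psubst_simps)

lemma lin_vars: "(\<And>i. i \<in> {1..t} \<Longrightarrow> poly_in_vars V (c i)) \<Longrightarrow> poly_in_vars V (lin c x)"
  unfolding lin_def by (intro vars_sum vars_mult) auto

text \<open>Orthogonality to each single cycle \<open>inc l\<close> is an integer identity, and a
  cycle with ring coefficients is a combination of these.\<close>

lemma lin_orthogonal:
  fixes c :: "nat \<Rightarrow> 'r::comm_ring_1"
  assumes "\<And>z. z \<in> range lin \<Longrightarrow> (\<Sum>x\<in>gnd N. z x * \<tau> x) = (0::int)"
  shows "(\<Sum>x\<in>gnd N. of_int (\<tau> x) * lin c x) = 0"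
proof -
  have "(\<Sum>x\<in>gnd N. inc l x * \<tau> x) = 0" if l: "l \<in> {1..t}" for l
  proof -
    have "inc l x = lin (\<lambda>i. if i = l then 1 else 0) x" for x
      unfolding lin_def using l by (simp add: if_distrib cong: if_cong)
    then show ?thesis using assms[of "lin (\<lambda>i. if i = l then 1 else 0)"] by simp
  qed
  then have "(\<Sum>l\<in>{1..t}. of_int (\<Sum>x\<in>gnd N. inc l x * \<tau> x) * c l) = 0" by simp
  also have "(\<Sum>l\<in>{1..t}. of_int (\<Sum>x\<in>gnd N. inc l x * \<tau> x) * c l)
      = (\<Sum>l\<in>{1..t}. \<Sum>x\<in>gnd N. of_int (\<tau> x) * (of_int (inc l x) * c l))"
    by (simp add: sum_distrib_right sum_distrib_left mult.assoc mult.left_commute)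
  also have "\<dots> = (\<Sum>x\<in>gnd N. of_int (\<tau> x) * lin c x)"
    unfolding lin_def sum_distrib_left by (rule sum.swap)
  finally show ?thesis .
qed

text \<open>For a cycle without private elements n_l - 1 = 1, so its variable has exponent 0
  throughout the box, and the value of h there is irrelevant.\<close>

lemma box_fixed:
  assumes "w \<in> bpolys box" "\<And>l. l \<in> {1..t} \<Longrightarrow> R l \<noteq> {} \<Longrightarrow> h l = var_poly l"
  shows "psubst h w = w"
proof (rule psubst_id)
  show "poly_in_vars {l \<in> {1..t}. R l \<noteq> {}} w" unfolding poly_in_vars_iff using assms(1)
  proof (rule bpolys_mono, intro allI)
    fix l
    have "n l - 1 = 1" if "l \<in> {1..t}" "R l = {}" using n_eq[OF that(1)] R_empty[OF that] that by auto
    then show "box l \<subseteq> vars_bound {l \<in> {1..t}. R l \<noteq> {}} l" unfolding box_eq vars_bound_def by auto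
  qed
qed (use assms(2) in auto)

lemma chain_gens_eq:
  "chain_gens t s 1 (var_poly 1 ^ (s 1 - 1)) =
    {\<Prod>x\<in>cmin e m C. lin var_poly x :: ('k::comm_ring_1) mpoly | C. C \<in> circuits N}" (is "?L = ?R")
proof -
  have prod: "(\<Prod>x\<in>cmin e m (join_cycles a b). lin var_poly x) =
    (if a = 1 then var_poly 1 ^ (s 1 - 1) * chain_tail t s 1 b
     else chain_head s a * chain_tail t s a b :: 'k mpoly)"
    if ab: "1 \<le> a" "a \<le> b" "b \<le> t" for a b
  proof (cases "a = 1")
    case True
    then show ?thesis using R_empty[of 1] t_pos
      unfolding cmin_join[OF ab] prod_lin_broken_circuit[OF ab] chain_tail_def by auto
  next
    case False
    then show ?thesis using ab s_zero_iff[of a]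
      unfolding cmin_join[OF ab] prod_lin_broken_circuit[OF ab] chain_tail_def chain_head_def by auto
  qed
  show ?thesis
  proof (intro equalityI subsetI)
    fix g assume "g \<in> ?L"
    then consider b where "1 \<le> b" "b \<le> t" "g = var_poly 1 ^ (s 1 - 1) * chain_tail t s 1 b"
      | a b where "1 < a" "a \<le> b" "b \<le> t" "g = chain_head s a * chain_tail t s a b"
      unfolding chain_gens_def by blast
    then obtain a b where "1 \<le> a" "a \<le> b" "b \<le> t" "g = (\<Prod>x\<in>cmin e m (join_cycles a b). lin var_poly x)"
    proof cases
      case 1
      then show ?thesis using prod[of 1 b] by (intro that[of 1 b]) auto
    next
      case 2
      then show ?thesis using prod[of a b] by (intro that[of a b]) auto
    qed
    then show "g \<in> ?R" using join_circuit by blast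
  next
    fix g assume "g \<in> ?R"
    then obtain C where C: "C \<in> circuits N" "g = (\<Prod>x\<in>cmin e m C. lin var_poly x)" by blast
    obtain a b where "1 \<le> a" "a \<le> b" "b \<le> t" "C = join_cycles a b" using C(1) by (rule circuit_cases)
    then show "g \<in> ?L" using C(2) prod[of a b] unfolding chain_gens_def by (cases "a = 1") auto
  qed
qed

text \<open>The substitutions \<open>\<phi>\<close> and \<open>face_var\<close> carry the two ideals
  into each other, and \<open>face_var\<close> after \<open>\<phi>\<close> is the identity modulo
  the ideal of \<open>N\<close>. Both fix the box, so independence is pulled back along
  \<open>\<phi>\<close> and spanning is carried over by \<open>face_var\<close>.\<close>

theorem NBC_basis: "has_NBC_basis TYPE('k::field) N"
proof -
  obtain \<tau> where "admissible_signing TYPE('k) N csign \<tau> \<and>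
     (\<forall>D\<in>cocircuits N. (\<forall>x. (x \<in> D \<longrightarrow> \<tau> D x \<in> {1, -1}) \<and> (x \<notin> D \<longrightarrow> \<tau> D x = 0)) \<and>
        (\<forall>z\<in>range lin. (\<Sum>x\<in>gnd N. z x * \<tau> D x) = 0))"
    using admissible_signing_exists by (rule exE)
  then have adm: "admissible_signing TYPE('k) N csign \<tau>"
    and \<tau>: "\<And>D x. D \<in> cocircuits N \<Longrightarrow> (x \<in> D \<longrightarrow> \<tau> D x \<in> {1, -1}) \<and> (x \<notin> D \<longrightarrow> \<tau> D x = 0)"
    and orth: "\<And>D z. D \<in> cocircuits N \<Longrightarrow> z \<in> range lin \<Longrightarrow> (\<Sum>x\<in>gnd N. z x * \<tau> D x) = 0"
    by blast+
  let ?I = "BC_ideal TYPE('k) N e \<tau>" and ?V = "{1..m}" and ?T = "{1..t}"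
  let ?G = "circuit_gens TYPE('k) N e \<union> Theta TYPE('k) N e \<tau>"
  define J :: "'k mpoly set" where "J = ideal_gen ?T (chain_gens t s 1 (var_poly 1 ^ (s 1 - 1)))"
  \<comment> \<open>The variable y_i is also written \<open>var_poly i\<close>, so
    \<open>\<phi>\<close> and \<open>face_var\<close> act on one polynomial type and it makes sense
    to say that they fix the box.\<close>
  define \<phi> :: "nat \<Rightarrow> 'k mpoly" where "\<phi> i = lin var_poly (e i)" for i
  have I: "?I = ideal_gen ?V ?G" by (simp add: BC_ideal_def)
  have coc: "fund_coc N B (e j) \<in> cocircuits N" if "j \<in> {t + 1..m}" for j
  proof -
    have "e j \<in> B" using that e_B by blast
    then show ?thesis using fund_coc_eq(2)[OF B_basis] by (simp add: cocircuits_def)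
  qed
  have theta: "(\<Sum>i\<in>?V. if e i \<in> D then of_int (\<tau> D (e i)) * var_poly i else 0)
      = (\<Sum>i\<in>?V. of_int (\<tau> D (e i)) * (var_poly i :: 'k mpoly))" if "D \<in> cocircuits N" for D
    using \<tau>[OF that] by (intro sum.cong) auto
  have relation: "(\<Sum>i\<in>?V. of_int (\<tau> D (e i)) * lin c (e i)) = 0"
    if "D \<in> cocircuits N" for D and c :: "nat \<Rightarrow> 'k mpoly"
    using lin_orthogonal[of "\<tau> D" c] orth[OF that] sum.reindex_bij_betw[OF e_bij, of "\<lambda>x. of_int (\<tau> D x) * lin c x"]
    by simp
  have Theta: "Theta TYPE('k) N e \<tau> =
     {(\<Sum>i\<in>?V. of_int (\<tau> (fund_coc N B (e j)) (e i)) * var_poly i) | j. j \<in> {t + 1..m}}"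
    unfolding Theta_def Let_def m_minus_rank e_B using theta[OF coc] by (intro Collect_cong ex_cong1) auto
  have broken: "x \<in> cmin e m C \<Longrightarrow> C \<in> circuits N \<Longrightarrow> idx x \<in> ?V \<and> e (idx x) = x" for x C
    using circuit_subset[of C] e_idx[of x] by (auto simp: cmin_def)
  have \<phi>_circuit: "psubst \<phi> (\<Prod>x\<in>cmin e m C. var_poly (idx x)) = (\<Prod>x\<in>cmin e m C. lin var_poly x)"
    if "C \<in> circuits N" for C
    unfolding psubst_prod using broken[OF _ that] by (intro prod.cong) (auto simp: \<phi>_def)
  have \<phi>_I: "psubst \<phi> f \<in> J" if "f \<in> ?I" for f
    using that unfolding I
  proof (induction f rule: ideal_gen_induct)
    case (gen c g)
    have "poly_in_vars ?T (psubst \<phi> c)"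
      by (rule psubst_vars[OF gen(2)]) (auto simp: \<phi>_def intro: lin_vars)
    moreover have "psubst \<phi> g \<in> J"
      using gen(1)
    proof
      assume "g \<in> circuit_gens TYPE('k) N e"
      then obtain C where C: "C \<in> circuits N" "g = (\<Prod>x\<in>cmin e m C. var_poly (idx x))"
        unfolding circuit_gens_def Let_def by blast
      then have "psubst \<phi> g = (\<Prod>x\<in>cmin e m C. lin var_poly x)" using \<phi>_circuit by simp
      then show ?thesis unfolding J_def chain_gens_eq using C(1) by (intro ideal_gen_gen) blast
    next
      assume "g \<in> Theta TYPE('k) N e \<tau>"
      then obtain j where j: "j \<in> {t + 1..m}" "g = (\<Sum>i\<in>?V. of_int (\<tau> (fund_coc N B (e j)) (e i)) * var_poly i)"
        unfolding Theta by blast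
      then have "psubst \<phi> g = 0"
        using relation[OF coc[OF j(1)], of var_poly] by (simp add: psubst_simps \<phi>_def)
      then show ?thesis by (simp add: J_def)
    qed
    ultimately show ?case unfolding psubst_mult J_def by (intro ideal_gen_mult)
  qed (auto simp: J_def psubst_add intro: ideal_gen_add)
  \<comment> \<open>For j > t, subtract from the generator of j in Theta the orthogonality relation
    for the cycle with coefficients \<open>face_var\<close>. Terms with i \<le> t vanish by the
    choice of \<open>face_var\<close>, and other basis elements are not in the cocircuit of
    \<open>e j\<close>; only the term at j remains, with a unit coefficient.\<close>
  have var_face: "var_poly j - lin face_var (e j) \<in> ?I" if j: "j \<in> ?V" for j
  proof (cases "j \<le> t")
    case True
    then have "j \<in> ?T" using j by auto
    then show ?thesis by (simp add: I e_pick lin_face_var_pick)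
  next
    case False
    then have jB: "j \<in> {t + 1..m}" using j by auto
    let ?D = "fund_coc N B (e j)"
    have ejB: "e j \<in> B" using e_B jB by blast
    have D: "?D = insert (e j) {y \<in> gnd N - B. e j \<in> fund_ci N B y}" by (rule fund_coc_eq(1)[OF B_basis ejB])
    have "of_int (\<tau> ?D (e i)) * (var_poly i - lin face_var (e i)) = (0 :: 'k mpoly)" if i: "i \<in> ?V - {j}" for i
    proof (cases "i \<le> t")
      case True
      then have "i \<in> ?T" using i by auto
      then show ?thesis by (simp add: e_pick lin_face_var_pick)
    next
      case False
      then have "i \<in> {t + 1..m}" using i by auto
      then have "e i \<in> B" using e_B by blast
      moreover have "e i \<noteq> e j" using i j inj_onD[OF bij_betw_imp_inj_on[OF e_bij], of i j] by auto
      ultimately have "e i \<notin> ?D" unfolding D by auto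
      then show ?thesis using \<tau>[OF coc[OF jB]] by simp
    qed
    then have "(\<Sum>i\<in>?V - {j}. of_int (\<tau> ?D (e i)) * (var_poly i - lin face_var (e i))) = (0 :: 'k mpoly)"
      by (intro sum.neutral ballI)
    then have "(\<Sum>i\<in>?V. of_int (\<tau> ?D (e i)) * (var_poly i - lin face_var (e i)))
        = of_int (\<tau> ?D (e j)) * (var_poly j - lin face_var (e j) :: 'k mpoly)"
      by (subst sum.remove[OF _ j]) auto
    moreover have "(\<Sum>i\<in>?V. of_int (\<tau> ?D (e i)) * (var_poly i - lin face_var (e i)))
        = (\<Sum>i\<in>?V. of_int (\<tau> ?D (e i)) * (var_poly i :: 'k mpoly))"
      using relation[OF coc[OF jB], of face_var] by (simp add: right_diff_distrib sum_subtractf)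
    moreover have "(\<Sum>i\<in>?V. of_int (\<tau> ?D (e i)) * (var_poly i :: 'k mpoly)) \<in> ?I"
      unfolding I Theta using jB by (intro ideal_gen_gen) blast
    ultimately have "of_int (\<tau> ?D (e j)) * (var_poly j - lin face_var (e j) :: 'k mpoly) \<in> ?I" by simp
    then have "of_int (\<tau> ?D (e j)) * (of_int (\<tau> ?D (e j)) * (var_poly j - lin face_var (e j) :: 'k mpoly)) \<in> ?I"
      unfolding I by (rule ideal_gen_mult) simp
    moreover have "\<tau> ?D (e j) * \<tau> ?D (e j) = 1" using \<tau>[OF coc[OF jB], of "e j"] D by auto
    then have "of_int (\<tau> ?D (e j)) * of_int (\<tau> ?D (e j)) = (1 :: 'k mpoly)" by (metis of_int_mult of_int_1)
    ultimately show ?thesis by (simp add: mult.assoc[symmetric])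
  qed
  have comp: "psubst face_var (psubst \<phi> f) = psubst (\<lambda>j. lin face_var (e j)) f" for f
    unfolding psubst_comp by (simp add: \<phi>_def psubst_lin)
  have face_V: "poly_in_vars ?V (face_var i)" if "i \<in> ?T" for i
    using face_var_vars[of i] that t_le by (auto elim: vars_mono)
  have retract: "f - psubst face_var (psubst \<phi> f) \<in> ?I" if "poly_in_vars ?V f" for f
    unfolding comp I using that
  proof (rule psubst_diff_in_ideal)
    fix i assume "i \<in> ?V"
    then show "var_poly i - lin face_var (e i) \<in> ideal_gen ?V ?G" using var_face unfolding I by blast
    show "poly_in_vars ?V (lin face_var (e i))" by (intro lin_vars face_V)
  qed
  have face_J: "psubst face_var f \<in> ?I" if "f \<in> J" for f
    using that unfolding J_def
  proof (induction f rule: ideal_gen_induct)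
    case (gen c g)
    then obtain C where C: "C \<in> circuits N" "g = (\<Prod>x\<in>cmin e m C. lin var_poly x)"
      unfolding chain_gens_eq by blast
    let ?g = "\<Prod>x\<in>cmin e m C. var_poly (idx x) :: 'k mpoly"
    have "?g \<in> ?I" unfolding I circuit_gens_def Let_def using C(1) by (intro ideal_gen_gen) blast
    moreover have "?g - psubst face_var (psubst \<phi> ?g) \<in> ?I"
      using broken[OF _ C(1)] by (intro retract vars_prod) auto
    \<comment> \<open>Each generator of \<open>J\<close> is the image under \<open>\<phi>\<close> of
      a circuit monomial, so applying \<open>face_var\<close> returns that monomial modulo the ideal
      of \<open>N\<close>.\<close>
    ultimately have "?g - (?g - psubst face_var (psubst \<phi> ?g)) \<in> ?I" unfolding I by (rule ideal_gen_diff)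
    then have "psubst face_var g \<in> ?I" using \<phi>_circuit[OF C(1)] C(2) by simp
    moreover have "poly_in_vars ?V (psubst face_var c)" by (rule psubst_vars[OF gen(2) face_V])
    ultimately show ?case unfolding psubst_mult I by (rule ideal_gen_mult)
  qed (auto simp: I psubst_add intro: ideal_gen_add)
  have dec: "poly_in_vars ?T f \<Longrightarrow> \<exists>w\<in>bpolys box. f - w \<in> J"
    and uniq: "w \<in> bpolys box \<Longrightarrow> w \<in> J \<Longrightarrow> w = 0" for f w
    using chain_decomposition[of 1 t "{}" "s 1 - 1" "var_poly 1 ^ (s 1 - 1)" s] t_pos monic_in_var_power[of "{}" 1 "s 1 - 1"]
    unfolding J_def by auto
  have \<phi>_box: "psubst \<phi> w = w" if "w \<in> bpolys box" for w
    using that by (rule box_fixed) (auto simp: \<phi>_def e_pick lin_R[OF _ pick_R])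
  have face_box: "psubst face_var w = (w :: 'k mpoly)" if "w \<in> bpolys box" for w
    using that by (rule box_fixed) (auto intro: face_var_R)
  have "monomials_basis_mod ?V ?I (L_set N e)"
    unfolding monomials_basis_mod_def
  proof (intro conjI allI impI ballI)
    fix F and c :: "(nat \<Rightarrow>\<^sub>0 nat) \<Rightarrow> 'k" and a
    assume F: "finite F \<and> F \<subseteq> L_set N e \<and> (\<Sum>a\<in>F. single a (c a)) \<in> ?I" and a: "a \<in> F"
    \<comment> \<open>A combination of box monomials in the ideal of \<open>N\<close> is its own
      image under \<open>\<phi>\<close>, hence lies in \<open>J\<close>, where only zero is
      possible.\<close>
    have "(\<Sum>a\<in>F. single a (c a)) \<in> bpolys box"
      using F unfolding L_set_eq by (intro bpolys_sum bpolys_single) auto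
    then have "(\<Sum>a\<in>F. single a (c a)) = 0" using uniq \<phi>_I \<phi>_box F by metis
    then have "(\<Sum>b\<in>F. lookup (single b (c b)) a) = 0" by (metis lookup_sum lookup_zero)
    then show "c a = 0" using F a by (simp add: lookup_single when_def)
  next
    fix f :: "'k mpoly" assume f: "poly_in_vars ?V f"
    have "poly_in_vars ?T (psubst \<phi> f)"
      by (rule psubst_vars[OF f]) (auto simp: \<phi>_def intro: lin_vars)
    then obtain w where w: "w \<in> bpolys box" "psubst \<phi> f - w \<in> J" using dec by blast
    have "(f - psubst face_var (psubst \<phi> f)) + psubst face_var (psubst \<phi> f - w) \<in> ?I"
      using retract[OF f] face_J[OF w(2)] unfolding I by (rule ideal_gen_add)
    then have "f - w \<in> ?I" using face_box[OF w(1)] by (simp add: psubst_diff)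
    moreover have "keys w \<subseteq> L_set N e" using w(1) unfolding L_set_eq bpolys_def by blast
    moreover have "w = (\<Sum>a\<in>keys w. single a (lookup w a))" by (rule poly_sum_singles)
    ultimately show "\<exists>F c. finite F \<and> F \<subseteq> L_set N e \<and> f - (\<Sum>a\<in>F. single a (c a)) \<in> ?I"
      by (metis finite_keys)
  qed
  then show ?thesis unfolding has_NBC_basis_def Let_def
    using e_bij B_basis adm unfolding m_minus_rank e_B[symmetric] by blast
qed

end

theorem theorem5p8:
  fixes t :: nat and n :: "nat \<Rightarrow> nat" and E :: "nat \<Rightarrow> 'a set" and p :: "nat \<Rightarrow> 'a"
  assumes "t \<ge> 1"
    and "\<And>i. i \<in> {1..t} \<Longrightarrow> finite (E i) \<and> card (E i) = n i \<and> n i \<ge> 2"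
    and "\<And>i. 1 \<le> i \<Longrightarrow> i \<le> t - 1 \<Longrightarrow> E i \<inter> E (i + 1) = {p (i + 1)}"
    and "\<And>i j. i \<in> {1..t} \<Longrightarrow> j \<in> {1..t} \<Longrightarrow> i + 2 \<le> j \<Longrightarrow> E i \<inter> E j = {}"
    and "\<And>i j. i \<in> {2..t} \<Longrightarrow> j \<in> {2..t} \<Longrightarrow> i \<noteq> j \<Longrightarrow> p i \<noteq> p j"
  shows "has_NBC_basis TYPE('k::field)
           (par_iter (\<lambda>i. uniform_matroid (n i - 1) (E i)) p (t - 1))"
proof -
  interpret cycle_chain t n E p using assms by unfold_locales
  obtain e where e: "bij_betw e {1..card (gnd N)} (gnd N)" "\<forall>i\<in>{1..t}. e i = pick i"
    using ordering_exists by blast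
  interpret ordered_chain t n E p e using e by unfold_locales auto
  show ?thesis using NBC_basis[where 'k = 'k] unfolding N_def .
qed

end
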